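(* There exists a minimal embedding of $S^{1}\times S^{1}\times S^1\times S^1$ in the round sphere $\mathbb{S}^{5}$.
   Context: $\mathbb{S}^{5}$ denotes the standard round unit sphere in $\mathbb{R}^{6}$. $S^1\times S^1\times S^1\times S^1$ is the four-dimensional torus as a smooth manifold. A minimal embedding is a smooth embedding whose image has vanishing mean curvature. *)

theory Defs
  imports "HOL-Analysis.Analysis"
begin

text \<open>Maps of class \<open>C\<^sup>k\<close> and \<open>C\<^sup>\<infinity>\<close>; meant for open sets \<open>S\<close>.\<close>

primrec Ck_on :: "nat \<Rightarrow> ('a::euclidean_space \<Rightarrow> 'b::euclidean_space) \<Rightarrow> 'a set \<Rightarrow> bool" where
  "Ck_on 0 f S \<longleftrightarrow> continuous_on S f"
| "Ck_on (Suc k) f S \<longleftrightarrow>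
     (\<forall>x\<in>S. f differentiable (at x)) \<and>
     (\<forall>v. Ck_on k (\<lambda>x. frechet_derivative f (at x) v) S)"

definition smooth_on :: "('a::euclidean_space \<Rightarrow> 'b::euclidean_space) \<Rightarrow> 'a set \<Rightarrow> bool" where
  "smooth_on f S \<longleftrightarrow> (\<forall>k. Ck_on k f S)"

definition immersion_on :: "('a::euclidean_space \<Rightarrow> 'b::euclidean_space) \<Rightarrow> 'a set \<Rightarrow> bool" where
  "immersion_on f S \<longleftrightarrow> smooth_on f S \<and> (\<forall>x\<in>S. inj (frechet_derivative f (at x)))"

definition partial :: "'n::finite \<Rightarrow> (real^'n \<Rightarrow> 'b::euclidean_space) \<Rightarrow> real^'n \<Rightarrow> 'b" where
  "partial i X t = frechet_derivative X (at t) (axis i 1)"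

definition first_fundamental_form ::
    "(real^'n::finite \<Rightarrow> 'b::euclidean_space) \<Rightarrow> real^'n \<Rightarrow> real^'n^'n" where
  "first_fundamental_form X t = (\<chi> i j. partial i X t \<bullet> partial j X t)"

text \<open>For \<open>X\<close> with values in the unit sphere, \<open>\<nu>\<close> is to be tangent to the sphere at \<open>X t\<close>, that is,
  orthogonal to \<open>X t\<close>, and normal to the hypersurface.\<close>

definition unit_normal ::
    "(real^'n::finite \<Rightarrow> 'b::euclidean_space) \<Rightarrow> real^'n \<Rightarrow> 'b \<Rightarrow> bool" where
  "unit_normal X t \<nu> \<longleftrightarrow>
     norm \<nu> = 1 \<and> X t \<bullet> \<nu> = 0 \<and> (\<forall>i. partial i X t \<bullet> \<nu> = 0)"

text \<open>The Levi-Civita connection of the sphere is the flat derivative followed by the orthogonal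
  projection along \<open>X t\<close>.  As \<open>\<nu>\<close> is orthogonal to \<open>X t\<close>, pairing with \<open>\<nu>\<close> makes the projection
  invisible, so the formula below is the second fundamental form of the hypersurface inside the
  sphere.\<close>

definition second_fundamental_form ::
    "(real^'n::finite \<Rightarrow> 'b::euclidean_space) \<Rightarrow> real^'n \<Rightarrow> 'b \<Rightarrow> real^'n^'n" where
  "second_fundamental_form X t \<nu> = (\<chi> i j. partial i (partial j X) t \<bullet> \<nu>)"

text \<open>Mean curvature is the (unnormalised) trace of the shape operator.\<close>

definition mean_curvature ::
    "(real^'n::finite \<Rightarrow> 'b::euclidean_space) \<Rightarrow> real^'n \<Rightarrow> 'b \<Rightarrow> real" where
  "mean_curvature X t \<nu> =
     trace (matrix_inv (first_fundamental_form X t) ** second_fundamental_form X t \<nu>)"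

abbreviation S5 :: "(real^6) set" where
  "S5 \<equiv> sphere 0 1"

definition local_parametrization ::
    "(real^6) set \<Rightarrow> (real^4) set \<Rightarrow> (real^4 \<Rightarrow> real^6) \<Rightarrow> bool" where
  "local_parametrization M U X \<longleftrightarrow>
     open U \<and> immersion_on X U \<and> openin (top_of_set M) (X ` U) \<and>
     (\<exists>Y. homeomorphism U (X ` U) X Y)"

text \<open>The vanishing of the mean curvature at a point depends neither on the local parametrization
  nor on the choice among the two unit normals.  Requiring a parametrization about each point makes
  \<open>M\<close> an embedded hypersurface.\<close>

definition minimal_hypersurface_S5 :: "(real^6) set \<Rightarrow> bool" where
  "minimal_hypersurface_S5 M \<longleftrightarrow>
     M \<subseteq> S5 \<and>
     (\<forall>p\<in>M. \<exists>U X. local_parametrization M U X \<and> p \<in> X ` U \<and>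
        (\<forall>t\<in>U. \<forall>\<nu>. unit_normal X t \<nu> \<longrightarrow> mean_curvature X t \<nu> = 0))"

abbreviation S1 :: "complex set" where
  "S1 \<equiv> sphere 0 1"

abbreviation T4 :: "(complex \<times> complex \<times> complex \<times> complex) set" where
  "T4 \<equiv> S1 \<times> S1 \<times> S1 \<times> S1"

text \<open>The smooth structure of the torus: the local inverses of the angle map are the charts of the
  product atlas, so a map \<open>F\<close> on the torus is smooth (an immersion) iff \<open>F \<circ> angles\<close> is.\<close>

definition angles :: "real^4 \<Rightarrow> complex \<times> complex \<times> complex \<times> complex" where
  "angles t = (cis (t $ 1), cis (t $ 2), cis (t $ 3), cis (t $ 4))"

definition smooth_embedding_T4 ::
    "(complex \<times> complex \<times> complex \<times> complex \<Rightarrow> real^6) \<Rightarrow> bool" where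
  "smooth_embedding_T4 F \<longleftrightarrow>
     immersion_on (F \<circ> angles) UNIV \<and> (\<exists>G. homeomorphism T4 (F ` T4) F G)"

definition minimal_embedding_T4_S5 ::
    "(complex \<times> complex \<times> complex \<times> complex \<Rightarrow> real^6) \<Rightarrow> bool" where
  "minimal_embedding_T4_S5 F \<longleftrightarrow>
     F ` T4 \<subseteq> S5 \<and> smooth_embedding_T4 F \<and> minimal_hypersurface_S5 (F ` T4)"

end

theory Submission
  imports Defs
begin

text \<open>
  The torus is invariant under the diagonal action of \<open>S\<^sup>1 \<times> S\<^sup>1 \<times> S\<^sup>1\<close> on \<open>\<complex>\<^sup>3\<close>: it is the orbit of a closed
  curve \<open>\<gamma>\<close> in the open positive octant of the two-sphere.  The curve is sought as the radial graph
  \<open>\<gamma>\<^sub>k = (g + cos (s + 2\<pi>k/3)) / \<bar>\<dots>\<bar>\<close>, \<open>k = 0, 1, 2\<close>, around the centre of the octant, which makes embeddedness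
  automatic; minimality becomes \<open>g'' + g = force g g' (cos 3s) (sin 3s)\<close>.  With \<open>e = g'' + 9/4 g\<close> this is a
  fixed-point equation for \<open>e\<close>, because \<open>g\<close> and \<open>g'\<close> are recovered from \<open>e\<close> by the Green operator of
  \<open>u'' + 9/4 u\<close> on \<open>2\<pi>/3\<close>-periodic functions, whose kernel \<open>sin (3t/2) / 3\<close> is nonnegative on a period and has
  integral \<open>4/9\<close>.  Near the explicit approximate solution \<open>g = 1.918 + 0.053 cos 3s - (cos 6s) / 1125\<close> the
  map is a contraction, so Banach's theorem gives an exact solution.
\<close>

section \<open>Estimates for the profile equation\<close>

text \<open>The number 9/4 does two jobs. On the tube around the approximate solution the slope of
  \<open>numer / denom\<close> in \<open>g\<close> lies in [-5/2, 0]; adding \<open>5/4 * g\<close>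
  centres this interval and halves the Lipschitz constant, and it turns the linear part g'' + g into
  g'' + 9/4 g. Its frequency 3/2 fits exactly half a wave into the period 2 pi / 3, whence the
  one-signed kernel. Without the shift these bounds give no contraction: the inverse of u'' + u
  fixes constants, so its norm is at least 1, against a slope bound of 5/2. With it, the contraction
  factor is 4/9 * 1.32 + 2/3 * 0.26 = 0.76, and the ball of radius 1/20 is preserved because 1.32 *
  0.0235 + 0.26 * 0.04 + 0.007 < 0.05. Iterating on e rather than on g keeps derivatives out of the
  function space: the sup norm controls both g and g' through the Green operator. The threefold
  symmetry leaves only cos 3s and sin 3s in the coefficients, which reduces the estimates to
  explicit polynomial inequalities.\<close>

text \<open>The difference of the two sides is expanded in the Bernstein basis of degree 7 on \<open>[-1, 1]\<close>, in which
  all its coefficients are nonnegative; likewise for the lower estimate.\<close>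

lemma residual_upper:
  fixes c g :: real
  assumes "\<bar>c\<bar> \<le> 1" and g: "g = 1918/1000 + 53/1000 * c"
  shows "(1 + 2*g^2 + 2*((159/1000)^2*(1-c^2))) * (12*g^2 - 3/2 - 3*g*c - 477/1000*(1-c^2))
    \<le> (43155/10000 - 35775/100000 * c + 3/100*(2*c^2-1) + 7/1000 - 5/4*g) * (1+2*g^2) * (4*g^3-3*g+c)" (is "?l \<le> ?r")
proof -
  have bernstein_nonneg: "0 \<le> (1+c)^i * (1-c)^j" for i j :: nat
    using assms(1) by simp
  have "?r - ?l = 65572818998247/5120000000000000 * ((1+c)^0*(1-c)^7) + 574270803218079/5120000000000000 * ((1+c)^1*(1-c)^6) + 8293403433327691/25600000000000000 * ((1+c)^2*(1-c)^5) + 54837400652646727/128000000000000000 * ((1+c)^3*(1-c)^4) + 180252377805822777/640000000000000000 * ((1+c)^4*(1-c)^3) + 1618891778868031529/16000000000000000000 * ((1+c)^5*(1-c)^2) + 110821989335075149/3200000000000000000 * ((1+c)^6*(1-c)^1) + 180551688256290881/16000000000000000000 * ((1+c)^7*(1-c)^0)"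
    unfolding g by algebra
  also have "\<dots> \<ge> 0"
    by (intro add_nonneg_nonneg mult_nonneg_nonneg[OF _ bernstein_nonneg]) auto
  finally show ?thesis by simp
qed

lemma residual_lower:
  fixes c g :: real
  assumes "\<bar>c\<bar> \<le> 1" and g: "g = 1918/1000 + 53/1000 * c"
  shows "(43155/10000 - 35775/100000 * c + 3/100*(2*c^2-1) - 7/1000 - 5/4*g) * (1+2*g^2) * (4*g^3-3*g+c) \<le>
   (1 + 2*g^2 + 2*((159/1000)^2*(1-c^2))) * (12*g^2 - 3/2 - 3*g*c - 477/1000*(1-c^2))" (is "?r \<le> ?l")
proof -
  have bernstein_nonneg: "0 \<le> (1+c)^i * (1-c)^j" for i j :: nat
    using assms(1) by simp
  have "?l - ?r = 4130934577011/1024000000000000 * ((1+c)^0*(1-c)^7) + 65098761652279/5120000000000000 * ((1+c)^1*(1-c)^6) + 74165470882139/1024000000000000 * ((1+c)^2*(1-c)^5) + 6908361731432243/25600000000000000 * ((1+c)^3*(1-c)^4) + 11665042059878473/25600000000000000 * ((1+c)^4*(1-c)^3) + 1169588141802477597/3200000000000000000 * ((1+c)^5*(1-c)^2) + 2069167300836426633/16000000000000000000 * ((1+c)^6*(1-c)^1) + 214096290497393033/16000000000000000000 * ((1+c)^7*(1-c)^0)"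
    unfolding g by algebra
  also have "\<dots> \<ge> 0"
    by (intro add_nonneg_nonneg mult_nonneg_nonneg[OF _ bernstein_nonneg]) auto
  finally show ?thesis by simp
qed

text \<open>\<open>denom\<close> is four times the product of the three numbers \<open>g + cos (s + 2\<pi>k/3)\<close> when \<open>c = cos 3s\<close>.\<close>

definition denom :: "real \<Rightarrow> real \<Rightarrow> real" where
  "denom g c = 4*g^3 - 3*g + c"

text \<open>Put C_k = cos (s + 2 pi k/3), S_k = sin (s + 2 pi k/3), and let the last two arguments
  be cos 3s and sin 3s. Then this is 2 times the sum over k of 1 - 2 g C_k + 2 p S_k, the normal
  direction, times the product of the two factors g + C_j with j different from k. Thus
  \<open>numer / denom\<close> is half the sum of (1 - 2 g C_k + 2 p S_k) / (g + C_k).\<close>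

definition numer :: "real \<Rightarrow> real \<Rightarrow> real \<Rightarrow> real \<Rightarrow> real" where
  "numer g p c s = 12*g^2 - 3/2 - 3*g*c + 3 * p * s"

text \<open>The first factor comes from the squared speed of the normalised curve, the second from
  the curvature of the three orbit circles.\<close>

definition force :: "real \<Rightarrow> real \<Rightarrow> real \<Rightarrow> real \<Rightarrow> real" where
  "force g p c s = (1 + 2*g^2 + 2*p^2) / (1 + 2*g^2) * (numer g p c s / denom g c)"

text \<open>The centre is a two-mode profile with its derivative: 159/1000 = 3 * 53/1000. The radii
  are what a ball of radius 1/20 for e leaves after the Green bounds, including the omitted second
  harmonic: 4/9 * 1/20 + 1/1125 < 235/10000 and 2/3 * 1/20 + 6/1125 < 4/100.\<close>

definition tube :: "real \<Rightarrow> real \<Rightarrow> real \<Rightarrow> real \<Rightarrow> bool" where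
  "tube g p c s \<longleftrightarrow> c^2 + s^2 = 1 \<and> \<bar>g - (1918/1000 + 53/1000 * c)\<bar> \<le> 235/10000
     \<and> \<bar>p + 159/1000 * s\<bar> \<le> 4/100"

section \<open>Polynomial bounds on the tube\<close>

lemma unit_circle_abs_le:
  fixes c s :: real
  assumes "c^2 + s^2 = 1"
  shows "\<bar>c\<bar> \<le> 1" "\<bar>s\<bar> \<le> 1"
proof -
  have "c^2 \<le> 1" "s^2 \<le> 1" using assms zero_le_power2[of c] zero_le_power2[of s] by linarith+
  then show "\<bar>c\<bar> \<le> 1" "\<bar>s\<bar> \<le> 1" by (simp_all add: abs_square_le_1)
qed

text \<open>In these coordinates the polynomials below have nonnegative coefficients.\<close>

lemma tube_coordinates:
  assumes "tube g p c s"
  obtains x y where "g = 18415/10000 + 53/1000 * y + x" "c = y - 1" "0 \<le> x" "x \<le> 47/1000" "0 \<le> y" "y \<le> 2"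
proof
  show "g = 18415/10000 + 53/1000 * (c+1) + (g - 18415/10000 - 53/1000 * (c+1))" by simp
  have "\<bar>c\<bar> \<le> 1" using assms unit_circle_abs_le by (auto simp: tube_def)
  moreover have "\<bar>g - (1918/1000 + 53/1000 * c)\<bar> \<le> 235/10000" using assms by (simp add: tube_def)
  ultimately show "0 \<le> g - 18415/10000 - 53/1000 * (c+1)" "g - 18415/10000 - 53/1000 * (c+1) \<le> 47/1000"
    "0 \<le> c+1" "c+1 \<le> 2"
    by argo+
qed simp

lemma tube_g_bounds:
  assumes "tube g p c s"
  shows "18415/10000 \<le> g" "g \<le> 19945/10000"
proof -
  obtain x y where "g = 18415/10000 + 53/1000 * y + x" "0 \<le> x" "x \<le> 47/1000" "0 \<le> y" "y \<le> 2"
    using assms by (rule tube_coordinates)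
  then show "18415/10000 \<le> g" "g \<le> 19945/10000" by linarith+
qed

text \<open>Since \<open>p\<close> is close to -159/1000 times \<open>s\<close>, the product is
  nearly nonpositive; completing the square in \<open>s\<close> bounds its positive part by q^2 / (4
  * 159/1000), where q is the deviation. These bounds place -3/2 + 3 p s between -21/10 and
  -1484/1000, the constants of the estimates below.\<close>

lemma tube_ps:
  assumes "tube g p c s"
  shows "-1/5 \<le> p * s" "3 * (p * s) \<le> 16/1000" "\<bar>p\<bar> \<le> 199/1000"
proof -
  have s: "\<bar>s\<bar> \<le> 1" using assms unit_circle_abs_le by (auto simp: tube_def)
  define q where "q = p + 159/1000 * s"
  have q: "\<bar>q\<bar> \<le> 4/100" using assms by (simp add: tube_def q_def)
  have p: "p = q - 159/1000 * s" by (simp add: q_def)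
  show pb: "\<bar>p\<bar> \<le> 199/1000" using q s unfolding p by linarith
  have "\<bar>p * s\<bar> \<le> 199/1000 * 1" unfolding abs_mult by (intro mult_mono pb s) auto
  then show "-1/5 \<le> p * s" by linarith
  have "p * s \<le> q^2 / (4 * (159/1000))"
    using zero_le_power2[of "q - 2 * (159/1000) * s"] unfolding p
    by (simp add: power2_eq_square algebra_simps)
  moreover have "q^2 \<le> (4/100)^2" using power_mono[OF q, of 2] by simp
  ultimately show "3 * (p * s) \<le> 16/1000" by (simp add: power2_eq_square)
qed

lemma tube_den_lower:
  assumes "tube g p c s"
  shows "184/10 \<le> denom g c"
proof -
  obtain x y where *: "g = 18415/10000 + 53/1000 * y + x" "c = y - 1" "0 \<le> x" "0 \<le> y"
    using assms by (rule tube_coordinates)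
  have "denom g c - 184/10 =
      109012987/2000000000 + 2997753751/1000000000 * (x^0 * y^1) + 31036641/500000000 * (x^0 * y^2) + 148877/250000000 * (x^0 * y^3) + 37693467/1000000 * (x^1 * y^0) + 585597/250000 * (x^1 * y^1) + 8427/250000 * (x^1 * y^2) + 11049/500 * (x^2 * y^0) + 159/250 * (x^2 * y^1) + 4 * (x^3 * y^0)"
    unfolding denom_def *(1,2) by algebra
  also have "\<dots> \<ge> 0"
    using *(3,4) by (intro add_nonneg_nonneg mult_nonneg_nonneg zero_le_power) auto
  finally show ?thesis by simp
qed

lemma tube_den_upper:
  assumes "tube g p c s"
  shows "denom g c \<le> 268/10"
proof -
  have g: "18415/10000 \<le> g" "g \<le> 19945/10000" using assms by (rule tube_g_bounds)+
  have "g^2 \<le> (19945/10000)^2" using g by (intro power_mono) auto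
  then have "g * (4*g^2-3) \<le> 19945/10000 * (4 * (19945/10000)^2 - 3)"
    using g power_mono[of "18415/10000" g 2] by (intro mult_mono) (auto simp: power2_eq_square)
  moreover have "c \<le> 1" using assms unit_circle_abs_le by (fastforce simp: tube_def)
  ultimately show ?thesis by (simp add: denom_def power2_eq_square power3_eq_cube algebra_simps)
qed

lemma tube_quotient_upper:
  assumes "tube g p c s"
  shows "12*g^2 - 3*g*c - 1484/1000 \<le> 245/100 * denom g c"
proof -
  obtain x y where *: "g = 18415/10000 + 53/1000 * y + x" "c = y - 1" "0 \<le> x" "0 \<le> y"
    using assms by (rule tube_coordinates)
  have "245/100 * denom g c - (12*g^2 - 3*g*c - 1484/1000) =
      19182956363/40000000000 + 207352173799/20000000000 * (x^0 * y^1) + 2773715409/10000000000 * (x^0 * y^2) + 7294973/5000000000 * (x^0 * y^3) + 903059883/20000000 * (x^1 * y^0) + 37334253/5000000 * (x^1 * y^1) + 412923/5000000 * (x^1 * y^2) + 421401/10000 * (x^2 * y^0) + 7791/5000 * (x^2 * y^1) + 49/5 * (x^3 * y^0)"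
    unfolding denom_def *(1,2) by algebra
  also have "\<dots> \<ge> 0"
    using *(3,4) by (intro add_nonneg_nonneg mult_nonneg_nonneg zero_le_power) auto
  finally show ?thesis by simp
qed

lemma tube_num_lower:
  assumes "tube g p c s"
  shows "375/10 \<le> 12*g^2 - 3*g*c - 21/10"
proof -
  obtain x y where *: "g = 18415/10000 + 53/1000 * y + x" "c = y - 1" "0 \<le> x" "0 \<le> y" "y \<le> 2"
    using assms by (rule tube_coordinates)
  have "12*g^2 - 3*g*c - 21/10 = 44117967/1000000 - 377889/125000 * (x^0 * y^1) - 31323/250000 * (x^0 * y^2) + 11799/250 * (x^1 * y^0) - 216/125 * (x^1 * y^1) + 12 * (x^2 * y^0)"
    unfolding *(1,2) by algebra
  moreover have "y^2 \<le> 2*y" "x*y \<le> 2*x" "0 \<le> x^2"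
    using *(3-5) by (auto simp: power2_eq_square mult_left_mono mult_right_mono mult.commute)
  ultimately show ?thesis
    using *(3-5) unfolding power_0 power_one_right mult_1 mult_1_right by linarith
qed

text \<open>With \<open>numer\<close> replaced by its upper bound, and after multiplication by the
  squared denominator, this says that the slope of \<open>numer / denom\<close> in \<open>g\<close>
  is at least -5/2. The companion estimate below says that it is at most 0.\<close>

lemma tube_deriv_lower:
  assumes "tube g p c s"
  shows "(12*g^2 - 3*g*c - 1484/1000) * (12*g^2-3) \<le> 25/10 * denom g c ^ 2 + (24*g-3*c) * denom g c"
proof -
  obtain x y where *: "g = 18415/10000 + 53/1000 * y + x" "c = y - 1" "0 \<le> x" "0 \<le> y"
    using assms by (rule tube_coordinates)
  have "25/10 * denom g c ^ 2 + (24*g-3*c) * denom g c - (12*g^2 - 3*g*c - 1484/1000) * (12*g^2-3) =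
      57956166992353862169/1600000000000000000 + 158148077618501364237/400000000000000000 * (x^0 * y^1) + 2899165481801896667/80000000000000000 * (x^0 * y^2) + 13015796018905599/10000000000000000 * (x^0 * y^3) + 435059349227627/20000000000000000 * (x^0 * y^4) + 4620642002157/25000000000000000 * (x^0 * y^5) + 22164361129/25000000000000000 * (x^0 * y^6) + 777566963152855929/400000000000000 * (x^1 * y^0) + 37190827006828239/40000000000000 * (x^1 * y^1) + 607911830881449/10000000000000 * (x^1 * y^2) + 7590686966559/5000000000000 * (x^1 * y^3) + 87181924569/5000000000000 * (x^1 * y^4) + 1254586479/12500000000000 * (x^1 * y^5) + 357088708053363/80000000000 * (x^2 * y^0) + 9039254544933/10000000000 * (x^2 * y^1) + 394681526409/10000000000 * (x^2 * y^2) + 1644941973/2500000000 * (x^2 * y^3) + 23671443/5000000000 * (x^2 * y^4) + 41562732987/10000000 * (x^3 * y^0) + 2262273751/5000000 * (x^3 * y^1) + 31036641/2500000 * (x^3 * y^2) + 148877/1250000 * (x^3 * y^3) + 38533467/20000 * (x^4 * y^0) + 585597/5000 * (x^4 * y^1) + 8427/5000 * (x^4 * y^2) + 11049/25 * (x^5 * y^0) + 318/25 * (x^5 * y^1) + 40 * (x^6 * y^0)"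
    unfolding denom_def *(1,2) by algebra
  also have "\<dots> \<ge> 0"
    using *(3,4) by (intro add_nonneg_nonneg mult_nonneg_nonneg zero_le_power) auto
  finally show ?thesis by simp
qed

lemma tube_deriv_upper:
  assumes "tube g p c s"
  shows "(24*g-3*c) * denom g c \<le> (12*g^2 - 3*g*c - 21/10) * (12*g^2-3)"
proof -
  have g: "18415/10000 \<le> g" "g \<le> 19945/10000" using assms by (rule tube_g_bounds)+
  have c: "\<bar>c\<bar> \<le> 1" using assms unit_circle_abs_le by (auto simp: tube_def)
  have "(24*g-3*c) * denom g c \<le> (509/10) * (268/10)"
    using g c tube_den_lower[OF assms] tube_den_upper[OF assms] by (intro mult_mono) auto
  \<comment> \<open>1364.12 against 1413.375: the slope stays away from 0, so separate bounds on the
    factors are sharp enough.\<close>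
  also have "\<dots> \<le> 375/10 * (37 + 69/100)" by simp
  also have "\<dots> \<le> (12*g^2 - 3*g*c - 21/10) * (12*g^2-3)"
  proof (rule mult_mono)
    have "(18415/10000)^2 \<le> g^2" using g by (intro power_mono) auto
    then show "37 + 69/100 \<le> 12*g^2-3" by (simp add: power2_eq_square)
  qed (use tube_num_lower[OF assms] in auto)
  finally show ?thesis .
qed

text \<open>The slope of the quotient lies in [-5/2, 0], so the added linear term moves it into
  [-5/4, 5/4]. For fixed \<open>p\<close>, \<open>c\<close>, \<open>s\<close> the tube is an
  interval in \<open>g\<close>, on which the mean value inequality applies.\<close>

lemma quotient_lipschitz_g:
  assumes "tube g1 p c s" "tube g2 p c s"
  shows "\<bar>(numer g1 p c s / denom g1 c + 5/4*g1) - (numer g2 p c s / denom g2 c + 5/4*g2)\<bar> \<le> 5/4 * \<bar>g1 - g2\<bar>"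
proof -
  define m where "m = 1918/1000 + 53/1000 * c"
  define S where "S = {m - 235/10000..m + 235/10000}"
  define f' where "f' g = ((24*g-3*c) * denom g c - numer g p c s * (12*g^2-3)) / denom g c ^ 2 + 5/4" for g
  have tube: "tube g p c s" if "g \<in> S" for g
    proof -
    have "\<bar>g - m\<bar> \<le> 235/10000" using that unfolding S_def atLeastAtMost_iff abs_le_iff by linarith
    then show ?thesis using assms(1) by (simp add: tube_def m_def)
  qed
  have "norm ((\<lambda>g. numer g p c s / denom g c + 5/4*g) g1 - (\<lambda>g. numer g p c s / denom g c + 5/4*g) g2) \<le> 5/4 * norm (g1 - g2)"
  proof (rule field_differentiable_bound)
    show "convex S" by (simp add: S_def)
    show "g1 \<in> S" "g2 \<in> S" using assms unfolding tube_def S_def m_def atLeastAtMost_iff abs_le_iff by linarith+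
    fix g assume g: "g \<in> S"
    note t = tube[OF g]
    have D: "denom g c > 0" using tube_den_lower[OF t] by linarith
    show "((\<lambda>g. numer g p c s / denom g c + 5/4*g) has_field_derivative f' g) (at g within S)"
      using D unfolding numer_def denom_def f'_def
      by (auto intro!: derivative_eq_intros simp: power2_eq_square algebra_simps)
    have "numer g p c s * (12*g^2-3) \<le> (12*g^2 - 3*g*c - 1484/1000) * (12*g^2-3)"
      "(12*g^2 - 3*g*c - 21/10) * (12*g^2-3) \<le> numer g p c s * (12*g^2-3)"
      using tube_ps[OF t] tube_g_bounds[OF t] power_mono[of "18415/10000" g 2] unfolding numer_def
      by (intro mult_right_mono; simp add: power2_eq_square mult.assoc)+
    then have "- (25/10) * denom g c ^ 2 \<le> (24*g-3*c) * denom g c - numer g p c s * (12*g^2-3)"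
       "(24*g-3*c) * denom g c - numer g p c s * (12*g^2-3) \<le> 0"
      using tube_deriv_lower[OF t] tube_deriv_upper[OF t] by linarith+
    then show "norm (f' g) \<le> 5/4"
      using D unfolding f'_def by (simp add: abs_le_iff field_simps)
  qed
  then show ?thesis by simp
qed

lemma tube_quotient_bounds:
  assumes "tube g p c s"
  shows "0 \<le> numer g p c s / denom g c" "numer g p c s / denom g c \<le> 245/100"
    "0 \<le> numer g 0 c s / denom g c" "numer g 0 c s / denom g c \<le> 245/100"
  using tube_quotient_upper[OF assms] tube_num_lower[OF assms] tube_ps[OF assms] tube_den_lower[OF assms]
  by (simp_all add: numer_def divide_simps mult.assoc)

lemma tube_curvature_factor:
  assumes "tube g p c s"
  shows "2 / (1 + 2*g^2) \<le> 2572/10000" "7781/1000 \<le> 1 + 2*g^2"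
proof -
  have "(18415/10000)^2 \<le> g^2" using tube_g_bounds[OF assms] by (intro power_mono) auto
  then show "7781/1000 \<le> 1 + 2*g^2" by (simp add: power2_eq_square)
  then have "2 / (1 + 2*g^2) \<le> 2 / (7781/1000)" by (intro divide_left_mono) auto
  then show "2 / (1 + 2*g^2) \<le> 2572/10000" by simp
qed

text \<open>This isolates the correction 2 p^2 / (1 + 2 g^2), at most 0.0102 on the tube, so that it
  raises the Lipschitz constant only from 5/4 to 132/100.\<close>

lemma force_alt:
  "force g p c s = numer g p c s / denom g c + 2*p^2 / (1 + 2*g^2) * (numer g p c s / denom g c)"
proof -
  have "1 + 2*g^2 > 0" by (simp add: add_pos_nonneg)
  then show ?thesis by (simp add: force_def add_divide_distrib distrib_right)
qed

lemma force_lipschitz_g: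
  assumes "tube g1 p c s" "tube g2 p c s"
  shows "\<bar>(force g1 p c s + 5/4*g1) - (force g2 p c s + 5/4*g2)\<bar> \<le> 132/100 * \<bar>g1 - g2\<bar>"
proof -
  define q1 q2 where "q1 = numer g1 p c s / denom g1 c" and "q2 = numer g2 p c s / denom g2 c"
  define r1 r2 where "r1 = 2*p^2 / (1 + 2*g1^2)" and "r2 = 2*p^2 / (1 + 2*g2^2)"
  define d where "d = \<bar>g1 - g2\<bar>"
  have d0: "0 \<le> d" by (simp add: d_def)
  have q: "\<bar>(q1 + 5/4*g1) - (q2 + 5/4*g2)\<bar> \<le> 5/4 * d"
    using quotient_lipschitz_g[OF assms] by (simp add: q1_def q2_def d_def)
  then have dq: "\<bar>q1 - q2\<bar> \<le> 5/2 * d" unfolding d_def by argo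
  have q2: "\<bar>q2\<bar> \<le> 245/100" using tube_quotient_bounds[OF assms(2)] by (simp add: q2_def)
  have p2: "2*p^2 \<le> 793/10000"
    using power_mono[OF tube_ps(3)[OF assms(1)], of 2] by (simp add: power2_eq_square)
  note k = tube_curvature_factor(2)[OF assms(1)] tube_curvature_factor(2)[OF assms(2)]
  have "r1 \<le> (793/10000) / (7781/1000)"
    unfolding r1_def by (intro frac_le k p2) auto
  moreover have "0 \<le> r1" by (simp add: r1_def)
  ultimately have r1: "\<bar>r1\<bar> \<le> 102/10000" by simp
  have "r1 - r2 = 2*p^2 * (2 * (g1 + g2)) * (g2 - g1) / ((1 + 2*g1^2) * (1 + 2*g2^2))"
    using k unfolding r1_def r2_def by (simp add: divide_simps) algebra
  then have "\<bar>r1 - r2\<bar> = (2*p^2 * (2 * (g1 + g2)) / ((1 + 2*g1^2) * (1 + 2*g2^2))) * d"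
    using k tube_g_bounds[OF assms(1)] tube_g_bounds[OF assms(2)] 
    by (simp add: abs_mult d_def abs_minus_commute)
  also have "\<dots> \<le> ((793/10000) * 8 / ((7781/1000) * (7781/1000))) * d"
    using tube_g_bounds[OF assms(1)] tube_g_bounds[OF assms(2)]
    by (intro mult_right_mono frac_le mult_mono k p2 d0) auto
  also have "\<dots> \<le> 105/10000 * d" using d0 by simp
  finally have dr: "\<bar>r1 - r2\<bar> \<le> 105/10000 * d" .
  have a: "\<bar>r1 * (q1 - q2)\<bar> \<le> 102/10000 * (5/2 * d)"
    unfolding abs_mult by (intro mult_mono r1 dq) (auto simp: d0)
  have b: "\<bar>(r1 - r2) * q2\<bar> \<le> (105/10000 * d) * (245/100)"
    unfolding abs_mult by (intro mult_mono q2 dr) (auto simp: d0)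
  have "(force g1 p c s + 5/4*g1) - (force g2 p c s + 5/4*g2) =
    ((q1 + 5/4*g1) - (q2 + 5/4*g2)) + r1 * (q1 - q2) + (r1 - r2) * q2"
    unfolding force_alt r1_def[symmetric] r2_def[symmetric] q1_def[symmetric] q2_def[symmetric] by algebra
  then show ?thesis using q a b d0 unfolding d_def[symmetric] by linarith
qed

text \<open>For fixed \<open>g\<close> the force has the form (1 + k p^2) (N + b p), so its
  difference quotient \<open>m\<close> is an explicit polynomial in both values of
  \<open>p\<close>.\<close>

lemma force_lipschitz_p:
  assumes "tube g p1 c s" "tube g p2 c s"
  shows "\<bar>force g p1 c s - force g p2 c s\<bar> \<le> 26/100 * \<bar>p1 - p2\<bar>"
proof -
  define k where "k = 2 / (1 + 2*g^2)"
  define N where "N = numer g 0 c s / denom g c"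
  define D where "D = denom g c"
  define m where "m = k * (p1 + p2) * N + 3 * s / D + 3 * s / D * (k * (p1^2 + p1*p2 + p2^2))"
  have k: "0 \<le> k" "k \<le> 2572/10000" using tube_curvature_factor[OF assms(1)] by (auto simp: k_def)
  have N: "0 \<le> N" "N \<le> 245/100" using tube_quotient_bounds[OF assms(1)] by (auto simp: N_def)
  have D: "184/10 \<le> D" using tube_den_lower[OF assms(1)] by (simp add: D_def)
  have s: "\<bar>s\<bar> \<le> 1" using assms unit_circle_abs_le by (auto simp: tube_def)
  have force: "force g p c s = (1 + k * p^2) * (N + 3 * s / D * p)" for p
  proof -
    have "1 + 2*g^2 > 0" by (simp add: add_pos_nonneg)
    then have "(1 + 2*g^2 + 2*p^2) / (1 + 2*g^2) = 1 + k * p^2"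
      by (simp add: k_def field_simps)
    moreover have "numer g p c s / denom g c = N + 3 * s / D * p"
      by (simp add: N_def D_def numer_def add_divide_distrib diff_divide_distrib)
    ultimately show ?thesis by (simp add: force_def)
  qed
  have "force g p1 c s - force g p2 c s = m * (p1 - p2)"
    unfolding force m_def by algebra
  moreover have "\<bar>m\<bar> \<le> 26/100"
  proof -
    \<comment> \<open>Substituting p1 + p2 = r1 + r2 - 318/1000 s pairs the two main contributions
      with opposite signs in 3/D - 318/1000 k N. Both are nonnegative, so the larger of them bounds
      the difference; adding absolute values would exceed 26/100.\<close>
    define r1 r2 where "r1 = p1 + 159/1000 * s" and "r2 = p2 + 159/1000 * s"
    have "\<bar>r1\<bar> \<le> 4/100" "\<bar>r2\<bar> \<le> 4/100" using assms by (simp_all add: tube_def r1_def r2_def)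
    then have r: "\<bar>r1 + r2\<bar> \<le> 8/100" by argo
    have "\<bar>k * N * (r1 + r2)\<bar> \<le> (2572/10000 * (245/100)) * (8/100)"
      unfolding abs_mult using k N r by (intro mult_mono) auto
    moreover have "\<bar>s * (3/D - 318/1000 * (k * N))\<bar> \<le> 1 * (201/1000)"
      unfolding abs_mult
    proof (intro mult_mono s)
      have "3/D \<le> 3 / (184/10)" using D by (intro divide_left_mono) auto
      moreover have "0 \<le> 3/D" using D by simp
      moreover have "k * N \<le> 2572/10000 * (245/100)" using k N by (intro mult_mono) auto
      moreover have "0 \<le> k * N" using k N by simp
      moreover have "\<bar>u - 318/1000 * v\<bar> \<le> 201/1000"
        if "u \<le> 3 / (184/10)" "0 \<le> u" "v \<le> 2572/10000 * (245/100)" "0 \<le> v" for u v :: real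
        using that by argo
      ultimately show "\<bar>3/D - 318/1000 * (k * N)\<bar> \<le> 201/1000" by blast
    qed auto
    moreover have "\<bar>3 * s / D * (k * (p1^2 + p1*p2 + p2^2))\<bar> \<le> 164/1000 * (2572/10000 * (12/100))"
      unfolding abs_mult
    proof (intro mult_mono)
      have "\<bar>3 * s / D\<bar> \<le> 3 / (184/10)" unfolding abs_divide using D s by (intro frac_le) auto
      then show "\<bar>3 * s / D\<bar> \<le> 164/1000" by simp
      have p: "\<bar>p1\<bar> \<le> 199/1000" "\<bar>p2\<bar> \<le> 199/1000" using tube_ps assms by blast+
      have "\<bar>p1^2\<bar> \<le> (199/1000)^2" "\<bar>p2^2\<bar> \<le> (199/1000)^2"
        using power_mono[OF p(1), of 2] power_mono[OF p(2), of 2] by simp_all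
      moreover have "\<bar>p1*p2\<bar> \<le> 199/1000 * (199/1000)" unfolding abs_mult by (intro mult_mono p) auto
      ultimately show "\<bar>p1^2 + p1*p2 + p2^2\<bar> \<le> 12/100"
        unfolding power2_eq_square[of "199/1000"] by argo
    qed (use k in auto)
    moreover have "m = k * N * (r1 + r2) + s * (3/D - 318/1000 * (k * N)) + 3 * s / D * (k * (p1^2 + p1*p2 + p2^2))"
      unfolding m_def r1_def r2_def by (simp add: algebra_simps)
    moreover have "\<bar>u + v + w\<bar> \<le> 26/100" if "\<bar>u\<bar> \<le> (2572/10000 * (245/100)) * (8/100)"
      "\<bar>v\<bar> \<le> 1 * (201/1000)" "\<bar>w\<bar> \<le> 164/1000 * (2572/10000 * (12/100))" for u v w :: real
      using that by argo
    ultimately show ?thesis by blast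
  qed
  ultimately show ?thesis by (metis abs_ge_zero abs_mult mult_right_mono)
qed

lemma tube_center:
  assumes "c^2 + s^2 = 1"
  shows "tube (1918/1000 + 53/1000 * c) (- 159/1000 * s) c s"
  using assms by (simp add: tube_def)

text \<open>The defect is measured at the centre of the tube, where s^2 = 1 - c^2 makes it a
  rational function of \<open>c\<close> alone; clearing the positive denominator leaves the two
  polynomial estimates in one variable. The second harmonic appears only in the value compared
  with.\<close>

lemma force_residual:
  assumes cs: "c^2 + s^2 = 1"
  shows "\<bar>force (1918/1000 + 53/1000 * c) (- 159/1000 * s) c s + 5/4 * (1918/1000 + 53/1000 * c)
    - (43155/10000 - 35775/100000 * c + 3/100*(2*c^2-1))\<bar> \<le> 7/1000"
proof -
  define g where "g = 1918/1000 + 53/1000 * c"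
  define e where "e = 43155/10000 - 35775/100000 * c + 3/100*(2*c^2-1)"
  have c: "\<bar>c\<bar> \<le> 1" using unit_circle_abs_le[OF cs] by simp
  have D: "denom g c > 0" using tube_den_lower[OF tube_center[OF cs]] by (simp add: g_def)
  have pos: "0 < (1 + 2*g^2) * denom g c" using D by (simp add: add_pos_nonneg)
  have s2: "s^2 = 1 - c^2" using cs by simp
  define Z where "Z = (1 + 2*g^2 + 2*((159/1000)^2*(1-c^2))) * (12*g^2 - 3/2 - 3*g*c - 477/1000*(1-c^2))"
  have "force g (- 159/1000 * s) c s = Z / ((1 + 2*g^2) * denom g c)"
    unfolding force_def numer_def Z_def s2[symmetric] by (simp add: power_mult_distrib power2_eq_square)
  moreover have "Z \<le> (e + 7/1000 - 5/4*g) * ((1+2*g^2) * denom g c)"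
    using residual_upper[OF c g_def] by (simp add: Z_def e_def denom_def mult.assoc)
  moreover have "(e - 7/1000 - 5/4*g) * ((1+2*g^2) * denom g c) \<le> Z"
    using residual_lower[OF c g_def] by (simp add: Z_def e_def denom_def mult.assoc)
  ultimately have "force g (- 159/1000 * s) c s \<le> e + 7/1000 - 5/4*g"
    "e - 7/1000 - 5/4*g \<le> force g (- 159/1000 * s) c s"
    using pos by (simp_all add: pos_divide_le_eq pos_le_divide_eq)
  then show ?thesis unfolding g_def[symmetric] e_def[symmetric] by linarith
qed

lemma force_lipschitz:
  assumes "tube g1 p1 c s" "tube g2 p2 c s"
  shows "\<bar>(force g1 p1 c s + 5/4*g1) - (force g2 p2 c s + 5/4*g2)\<bar>
    \<le> 132/100 * \<bar>g1 - g2\<bar> + 26/100 * \<bar>p1 - p2\<bar>"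
proof -
  have "tube g2 p1 c s" using assms by (simp add: tube_def)
  from force_lipschitz_g[OF assms(1) this] force_lipschitz_p[OF this assms(2)] show ?thesis by linarith
qed

section \<open>The periodic Green operator\<close>

text \<open>As \<open>3/2 \<sdot> 2\<pi>/3 = \<pi>\<close>, the kernel \<open>sin (3/2 t)\<close> on \<open>[0, 2\<pi>/3]\<close> extends continuously to a periodic function, whose
  corners produce the Dirac mass.\<close>

definition green :: "(real \<Rightarrow> real) \<Rightarrow> real \<Rightarrow> real" where
  "green f x = 1/3 * integral {x - 2*pi/3..x} (\<lambda>t. sin (3/2*(x-t)) * f t)"

definition green' :: "(real \<Rightarrow> real) \<Rightarrow> real \<Rightarrow> real" where
  "green' f x = 1/2 * integral {x - 2*pi/3..x} (\<lambda>t. cos (3/2*(x-t)) * f t)"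

lemma antiderivative_exists:
  fixes f :: "real \<Rightarrow> real"
  assumes "continuous_on UNIV f"
  obtains F where "\<And>x. (F has_real_derivative f x) (at x)"
proof -
  have "isCont f x" for x using assms by (simp add: continuous_on_eq_continuous_at)
  then have "\<exists>F. \<forall>x::real. -\<infinity> < ereal x \<longrightarrow> ereal x < \<infinity> \<longrightarrow> (F has_vector_derivative f x) (at x)"
    by (intro einterval_antiderivative) auto
  then show ?thesis using that by (auto simp: has_real_derivative_iff_has_vector_derivative)
qed

lemma integral_eq_antiderivative_diff:
  fixes f F :: "real \<Rightarrow> real"
  assumes "a \<le> b" "\<And>x. (F has_real_derivative f x) (at x)"
  shows "integral {a..b} f = F b - F a"
proof (rule integral_unique[OF fundamental_theorem_of_calculus[OF assms(1)]])
  show "(F has_vector_derivative f x) (at x within {a..b})" for x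
    using assms(2)[of x] by (simp add: has_real_derivative_iff_has_vector_derivative has_vector_derivative_at_within)
qed

lemma shift_sin_cos:
  "sin (3/2*(x - 2*pi/3)) = - sin (3/2*x)" "cos (3/2*(x - 2*pi/3)) = - cos (3/2*x)"
  by (simp_all add: right_diff_distrib sin_diff cos_diff)

text \<open>The sine kernel vanishes at both ends of the window, so the moving ends contribute
  nothing to the derivative of \<open>green\<close>. The cosine kernel takes the values 1 and -1
  there; by periodicity the two end terms are equal and add up to \<open>f x\<close>. The addition
  formulas first separate \<open>x\<close> from the integration variable, leaving two
  antiderivatives \<open>S\<close> and \<open>C\<close> without parameter.\<close>

lemma
  assumes f: "continuous_on UNIV f" and per: "\<And>t. f (t + 2*pi/3) = f t"
  shows green_has_derivative: "(green f has_real_derivative green' f x) (at x)"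
    and green'_has_derivative: "(green' f has_real_derivative f x - 9/4 * green f x) (at x)"
proof -
  have "continuous_on UNIV (\<lambda>x. sin (3/2*x) * f x)" "continuous_on UNIV (\<lambda>x. cos (3/2*x) * f x)"
    by (intro continuous_intros f)+
  then obtain S C where S: "\<And>x. (S has_real_derivative sin (3/2*x) * f x) (at x)"
    and C: "\<And>x. (C has_real_derivative cos (3/2*x) * f x) (at x)"
    by (meson antiderivative_exists)
  have per': "f (x - 2*pi/3) = f x" for x using per[of "x - 2*pi/3"] by simp
  have shift: "((\<lambda>x. x - 2*pi/3) has_real_derivative 1) (at x)" for x
    by (auto intro!: derivative_eq_intros)
  have S': "((\<lambda>x. S (x - 2*pi/3)) has_real_derivative - sin (3/2*x) * f x) (at x)" for x
    using DERIV_chain2[OF S shift] by (simp only: shift_sin_cos per' mult_1_right)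
  have C': "((\<lambda>x. C (x - 2*pi/3)) has_real_derivative - cos (3/2*x) * f x) (at x)" for x
    using DERIV_chain2[OF C shift] by (simp only: shift_sin_cos per' mult_1_right)
  have le: "x - 2*pi/3 \<le> x" for x by simp
  have "((\<lambda>t. sin (3/2*x) * C t - cos (3/2*x) * S t) has_real_derivative sin (3/2*(x-t)) * f t) (at t)" for x t
    by (rule DERIV_cong[OF DERIV_diff[OF DERIV_cmult[OF C] DERIV_cmult[OF S]]])
      (simp only: right_diff_distrib[of "3/2"] sin_diff left_diff_distrib mult.assoc)
  from integral_eq_antiderivative_diff[OF le this]
  have green: "green f x = 1/3 * (sin (3/2*x) * (C x - C (x - 2*pi/3)) - cos (3/2*x) * (S x - S (x - 2*pi/3)))" for x
    unfolding green_def right_diff_distrib[of "sin _"] right_diff_distrib[of "cos _"] by simp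
  have "((\<lambda>t. cos (3/2*x) * C t + sin (3/2*x) * S t) has_real_derivative cos (3/2*(x-t)) * f t) (at t)" for x t
    by (rule DERIV_cong[OF DERIV_add[OF DERIV_cmult[OF C] DERIV_cmult[OF S]]])
      (simp only: right_diff_distrib[of "3/2"] cos_diff distrib_right mult.assoc)
  from integral_eq_antiderivative_diff[OF le this]
  have green': "green' f x = 1/2 * (cos (3/2*x) * (C x - C (x - 2*pi/3)) + sin (3/2*x) * (S x - S (x - 2*pi/3)))" for x
    unfolding green'_def right_diff_distrib[of "sin _"] right_diff_distrib[of "cos _"] by simp
  have trig: "((\<lambda>x. sin (3/2*x)) has_real_derivative 3/2 * cos (3/2*x)) (at x)"
    "((\<lambda>x. cos (3/2*x)) has_real_derivative - 3/2 * sin (3/2*x)) (at x)" for x :: real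
    by (auto intro!: derivative_eq_intros)
  have sq: "sin (3/2*x) ^ 2 + cos (3/2*x) ^ 2 = 1" by (rule sin_cos_squared_add)
  have alg: "1/3 * (3/2 * c * X + (c * e - - c * e) * s - (- 3/2 * s * Y + (s * e - - s * e) * c)) =
    1/2 * (c * X + s * Y)" for s c e X Y :: real
    by (simp add: field_simps)
  show "(green f has_real_derivative green' f x) (at x)"
    unfolding green[abs_def] green'
    by (rule DERIV_cong[OF DERIV_cmult[OF DERIV_diff[OF DERIV_mult[OF trig(1) DERIV_diff[OF C C']]
        DERIV_mult[OF trig(2) DERIV_diff[OF S S']]]]]) (rule alg)
  have alg: "1/2 * (- 3/2 * s * X + (c * e - - c * e) * c + (3/2 * c * Y + (s * e - - s * e) * s)) =
    e - 9/4 * (1/3 * (s * X - c * Y))" if "s^2 + c^2 = 1" for s c e X Y :: real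
  proof -
    have "e = e * (s^2 + c^2)" by (simp add: that)
    then show ?thesis by (simp add: field_simps power2_eq_square)
  qed
  show "(green' f has_real_derivative f x - 9/4 * green f x) (at x)"
    unfolding green'[abs_def] green
    by (rule DERIV_cong[OF DERIV_cmult[OF DERIV_add[OF DERIV_mult[OF trig(2) DERIV_diff[OF C C']]
        DERIV_mult[OF trig(1) DERIV_diff[OF S S']]]]]) (rule alg[OF sq])
qed

lemma continuous_on_UNIV_integrable:
  fixes f :: "real \<Rightarrow> real"
  assumes "continuous_on UNIV f"
  shows "f integrable_on {a..b}"
  by (rule integrable_continuous_real[OF continuous_on_subset[OF assms subset_UNIV]])

lemma integral_nonneg_kernel_bound:
  fixes f k K :: "real \<Rightarrow> real"
  assumes "a \<le> b" "continuous_on UNIV f" "continuous_on UNIV k"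
    and k: "\<And>x. x \<in> {a..b} \<Longrightarrow> 0 \<le> k x" and f: "\<And>x. \<bar>f x\<bar> \<le> d"
    and K: "\<And>x. (K has_real_derivative k x) (at x)"
  shows "\<bar>integral {a..b} (\<lambda>x. k x * f x)\<bar> \<le> d * (K b - K a)"
proof -
  have "\<bar>integral {a..b} (\<lambda>x. k x * f x)\<bar> \<le> integral {a..b} (\<lambda>x. d * k x)"
    unfolding real_norm_def[symmetric]
  proof (rule integral_norm_bound_integral)
    fix x assume "x \<in> {a..b}"
    then show "norm (k x * f x) \<le> d * k x"
      using mult_left_mono[OF f[of x] k[of x]] k[of x] by (simp add: abs_mult mult.commute)
  qed (intro continuous_on_UNIV_integrable continuous_on_mult continuous_on_const assms)+
  also have "\<dots> = d * (K b - K a)"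
    by (simp add: integral_eq_antiderivative_diff[OF assms(1) K])
  finally show ?thesis .
qed

lemma kernel_facts:
  fixes x :: real
  shows "continuous_on UNIV (\<lambda>t. sin (3/2*(x-t)))" "continuous_on UNIV (\<lambda>t. cos (3/2*(x-t)))"
    "((\<lambda>t. sin (3/2*(x-t))) has_real_derivative - 3/2 * cos (3/2*(x-t))) (at t)"
    "((\<lambda>t. cos (3/2*(x-t))) has_real_derivative 3/2 * sin (3/2*(x-t))) (at t)"
  by (intro continuous_intros)+ (auto intro!: derivative_eq_intros)

lemma green_bound:
  assumes f: "continuous_on UNIV f" and d: "\<And>t. \<bar>f t\<bar> \<le> d"
  shows "\<bar>green f x\<bar> \<le> 4/9 * d"
proof -
  have "\<bar>integral {x - 2*pi/3..x} (\<lambda>t. sin (3/2*(x-t)) * f t)\<bar>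
    \<le> d * (2/3 * cos (3/2*(x-x)) - 2/3 * cos (3/2*(x - (x - 2*pi/3))))"
  proof (rule integral_nonneg_kernel_bound[where K = "\<lambda>t. 2/3 * cos (3/2*(x-t))", OF _ f kernel_facts(1) _ d])
    fix t assume "t \<in> {x - 2*pi/3..x}"
    then show "0 \<le> sin (3/2*(x-t))" by (intro sin_ge_zero) (simp_all add: field_simps)
  next
    show "((\<lambda>t. 2/3 * cos (3/2*(x-t))) has_real_derivative sin (3/2*(x-t))) (at t)" for t
      by (rule DERIV_cong[OF DERIV_cmult[OF kernel_facts(4)]]) simp
  qed simp
  then show ?thesis by (simp add: green_def abs_mult)
qed

text \<open>The cosine kernel changes sign once, in the middle of the period. Each half has absolute
  integral 2/3, and the prefactor is 1/2.\<close>

lemma green'_bound: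
  assumes f: "continuous_on UNIV f" and d: "\<And>t. \<bar>f t\<bar> \<le> d"
  shows "\<bar>green' f x\<bar> \<le> 2/3 * d"
proof -
  have "\<bar>integral {x - pi/3..x} (\<lambda>t. cos (3/2*(x-t)) * f t)\<bar>
    \<le> d * (- 2/3 * sin (3/2*(x-x)) - - 2/3 * sin (3/2*(x - (x - pi/3))))"
  proof (rule integral_nonneg_kernel_bound[where K = "\<lambda>t. - 2/3 * sin (3/2*(x-t))", OF _ f kernel_facts(2) _ d])
    fix t assume "t \<in> {x - pi/3..x}"
    then show "0 \<le> cos (3/2*(x-t))" by (intro cos_ge_zero) (simp_all add: field_simps)
  next
    show "((\<lambda>t. - 2/3 * sin (3/2*(x-t))) has_real_derivative cos (3/2*(x-t))) (at t)" for t
      by (rule DERIV_cong[OF DERIV_cmult[OF kernel_facts(3)]]) simp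
  qed simp
  then have 1: "\<bar>integral {x - pi/3..x} (\<lambda>t. cos (3/2*(x-t)) * f t)\<bar> \<le> 2/3 * d" by simp
  have "\<bar>integral {x - 2*pi/3..x-pi/3} (\<lambda>t. - cos (3/2*(x-t)) * f t)\<bar>
    \<le> d * (2/3 * sin (3/2*(x-(x-pi/3))) - 2/3 * sin (3/2*(x - (x - 2*pi/3))))"
  proof (rule integral_nonneg_kernel_bound[where K = "\<lambda>t. 2/3 * sin (3/2*(x-t))", OF _ f
        continuous_on_minus[OF kernel_facts(2)] _ d])
    fix t assume "t \<in> {x - 2*pi/3..x - pi/3}"
    then have "0 \<le> cos (pi - 3/2*(x-t))" by (intro cos_ge_zero) (simp_all add: field_simps)
    then show "0 \<le> - cos (3/2*(x-t))" by simp
  next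
    show "((\<lambda>t. 2/3 * sin (3/2*(x-t))) has_real_derivative - cos (3/2*(x-t))) (at t)" for t
      by (rule DERIV_cong[OF DERIV_cmult[OF kernel_facts(3)]]) simp
  qed simp
  then have 2: "\<bar>integral {x - 2*pi/3..x-pi/3} (\<lambda>t. cos (3/2*(x-t)) * f t)\<bar> \<le> 2/3 * d" by simp
  have "integral {x - 2*pi/3..x-pi/3} (\<lambda>t. cos (3/2*(x-t)) * f t) + integral {x - pi/3..x} (\<lambda>t. cos (3/2*(x-t)) * f t)
    = integral {x - 2*pi/3..x} (\<lambda>t. cos (3/2*(x-t)) * f t)"
    by (intro Henstock_Kurzweil_Integration.integral_combine continuous_on_UNIV_integrable
        continuous_on_mult kernel_facts f) auto
  with 1 2 show ?thesis unfolding green'_def abs_mult by argo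
qed

lemma
  assumes f: "continuous_on UNIV f" and h: "continuous_on UNIV h"
  shows green_diff: "green (\<lambda>t. f t - h t) x = green f x - green h x"
    and green'_diff: "green' (\<lambda>t. f t - h t) x = green' f x - green' h x"
proof -
  have *: "integral {a..b} (\<lambda>t. k t * (f t - h t)) = integral {a..b} (\<lambda>t. k t * f t) - integral {a..b} (\<lambda>t. k t * h t)"
    if "continuous_on UNIV k" for k and a b :: real
    unfolding right_diff_distrib
    by (intro Henstock_Kurzweil_Integration.integral_diff continuous_on_UNIV_integrable continuous_on_mult that f h)
  show "green (\<lambda>t. f t - h t) x = green f x - green h x"
    unfolding green_def *[OF kernel_facts(1)] by simp
  show "green' (\<lambda>t. f t - h t) x = green' f x - green' h x"
    unfolding green'_def *[OF kernel_facts(2)] by simp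
qed

text \<open>Two integrations by parts, packed into one antiderivative each. The kernel values at the
  two ends, opposite for the cosine and zero for the sine, combine with periodicity to leave 3 u and
  2 u'. This evaluates the Green operator on a trigonometric polynomial without computing
  integrals.\<close>

lemma
  assumes u: "\<And>t. (u has_real_derivative u' t) (at t)" and u': "\<And>t. (u' has_real_derivative u'' t) (at t)"
    and per: "\<And>t. u (t + 2*pi/3) = u t" "\<And>t. u' (t + 2*pi/3) = u' t"
  shows green_inverse: "green (\<lambda>t. u'' t + 9/4 * u t) x = u x"
    and green'_inverse: "green' (\<lambda>t. u'' t + 9/4 * u t) x = u' x"
proof -
  have per': "u (x - 2*pi/3) = u x" "u' (x - 2*pi/3) = u' x" using per[of "x - 2*pi/3"] by simp_all
  have alg: "w * s + - 3/2 * c * v + (3/2 * v * c + 3/2 * s * (3/2 * z)) = s * (w + 9/4 * z)" for c s v w z :: real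
    by (simp add: field_simps)
  have s: "((\<lambda>t. u' t * sin (3/2*(x-t)) + 3/2 * u t * cos (3/2*(x-t))) has_real_derivative
    sin (3/2*(x-t)) * (u'' t + 9/4 * u t)) (at t)" for t
    by (rule DERIV_cong[OF DERIV_add[OF DERIV_mult[OF u' kernel_facts(3)] DERIV_mult[OF DERIV_cmult[OF u] kernel_facts(4)]]]) (rule alg)
  have alg: "w * c + 3/2 * s * v - (3/2 * v * s + - 3/2 * c * (3/2 * z)) = c * (w + 9/4 * z)" for c s v w z :: real
    by (simp add: field_simps)
  have c: "((\<lambda>t. u' t * cos (3/2*(x-t)) - 3/2 * u t * sin (3/2*(x-t))) has_real_derivative
    cos (3/2*(x-t)) * (u'' t + 9/4 * u t)) (at t)" for t
    by (rule DERIV_cong[OF DERIV_diff[OF DERIV_mult[OF u' kernel_facts(4)] DERIV_mult[OF DERIV_cmult[OF u] kernel_facts(3)]]]) (rule alg)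
  have trig: "sin (3/2*(x-x)) = 0" "cos (3/2*(x-x)) = 1"
    "sin (3/2*(x-(x-2*pi/3))) = 0" "cos (3/2*(x-(x-2*pi/3))) = -1"
    by simp_all
  have le: "x - 2*pi/3 \<le> x" by simp
  show "green (\<lambda>t. u'' t + 9/4 * u t) x = u x"
    unfolding green_def integral_eq_antiderivative_diff[OF le s] trig per' by simp
  show "green' (\<lambda>t. u'' t + 9/4 * u t) x = u' x"
    unfolding green'_def integral_eq_antiderivative_diff[OF le c] trig per' by simp
qed

section \<open>The profile curve\<close>

text \<open>This is g'' + 9/4 g for g = \<open>green_guess\<close>: the operator multiplies
  constants by 9/4, cos 3t by -27/4 and cos 6t by -135/4, which explains the coefficient 1/1125 =
  (3/100) / (135/4). The last bracket is cos 6t, written as a polynomial in cos 3t to match the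
  residual estimates.\<close>

definition guess :: "real \<Rightarrow> real" where
  "guess t = 43155/10000 - 35775/100000 * cos (3*t) + 3/100 * (2 * cos (3*t)^2 - 1)"

definition green_guess :: "real \<Rightarrow> real" where
  "green_guess t = 1918/1000 + 53/1000 * cos (3*t) - 1/1125 * cos (6*t)"

definition green_guess' :: "real \<Rightarrow> real" where
  "green_guess' t = - 159/1000 * sin (3*t) + 6/1125 * sin (6*t)"

lemma continuous_guess: "continuous_on UNIV guess"
  unfolding guess_def[abs_def] by (intro continuous_intros)

lemma trig_periodic:
  "cos (3 * (t + 2*pi/3)) = cos (3*t)" "sin (3 * (t + 2*pi/3)) = sin (3*t)"
  "cos (6 * (t + 2*pi/3)) = cos (6*t)" "sin (6 * (t + 2*pi/3)) = sin (6*t)"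
proof -
  have *: "3 * (t + 2*pi/3) = 3*t + 2*pi" "6 * (t + 2*pi/3) = (6*t + 2*pi) + 2*pi" by simp_all
  show "cos (3 * (t + 2*pi/3)) = cos (3*t)" "sin (3 * (t + 2*pi/3)) = sin (3*t)"
  "cos (6 * (t + 2*pi/3)) = cos (6*t)" "sin (6 * (t + 2*pi/3)) = sin (6*t)"
    unfolding * by (simp_all only: cos_periodic sin_periodic)
qed

lemma
  shows green_guess: "green guess x = green_guess x"
    and green'_guess: "green' guess x = green_guess' x"
proof -
  define u'' where "u'' t = - 477/1000 * cos (3*t) + 36/1125 * cos (6*t)" for t :: real
  have cos6: "2 * cos (3*t)^2 = 1 + cos (6*t)" for t :: real
    using cos_double_cos[of "3*t"] by simp
  have "guess t = u'' t + 9/4 * green_guess t" for t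
    unfolding guess_def u''_def green_guess_def cos6 by (simp add: field_simps)
  then have guess: "guess = (\<lambda>t. u'' t + 9/4 * green_guess t)" ..
  have d: "(green_guess has_real_derivative green_guess' t) (at t)"
    "(green_guess' has_real_derivative u'' t) (at t)" for t
    unfolding green_guess_def[abs_def] green_guess'_def[abs_def] u''_def
    by (auto intro!: derivative_eq_intros)
  have per: "green_guess (t + 2*pi/3) = green_guess t" "green_guess' (t + 2*pi/3) = green_guess' t" for t
    unfolding green_guess_def green_guess'_def trig_periodic by simp_all
  show "green guess x = green_guess x" "green' guess x = green_guess' x"
    unfolding guess by (rule green_inverse green'_inverse; fact d per)+
qed

lemma green_tube:
  assumes e: "continuous_on UNIV e" and d: "\<And>t. \<bar>e t - guess t\<bar> \<le> 1/20"
  shows "tube (green e t) (green' e t) (cos (3*t)) (sin (3*t))"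
proof -
  have c: "continuous_on UNIV (\<lambda>t. e t - guess t)"
    by (intro continuous_on_diff e continuous_guess)
  have "\<bar>green e t - green_guess t\<bar> \<le> 4/9 * (1/20)"
    using green_bound[OF c d, of t] by (simp add: green_diff[OF e continuous_guess] green_guess)
  moreover have "\<bar>green' e t - green_guess' t\<bar> \<le> 2/3 * (1/20)"
    using green'_bound[OF c d, of t] by (simp add: green'_diff[OF e continuous_guess] green'_guess)
  moreover have "\<bar>cos (6*t)\<bar> \<le> 1" "\<bar>sin (6*t)\<bar> \<le> 1" by simp_all
  moreover have "\<bar>x - (a + b * c)\<bar> \<le> 235/10000"
    if "\<bar>x - (a + b * c - 1/1125 * y)\<bar> \<le> 4/9 * (1/20)" "\<bar>y\<bar> \<le> 1" for x y a b c :: real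
    using that by argo
  moreover have "\<bar>x + 159/1000 * s\<bar> \<le> 4/100"
    if "\<bar>x - (- 159/1000 * s + 6/1125 * y)\<bar> \<le> 2/3 * (1/20)" "\<bar>y\<bar> \<le> 1" for x y s :: real
    using that by argo
  ultimately show ?thesis
    unfolding tube_def green_guess_def green_guess'_def by (metis sin_cos_squared_add2 add.commute)
qed

section \<open>The contraction and its fixed point\<close>

definition profile_map :: "(real \<Rightarrow> real) \<Rightarrow> real \<Rightarrow> real" where
  "profile_map e t = force (green e t) (green' e t) (cos (3*t)) (sin (3*t)) + 5/4 * green e t"

lemma profile_map_near_guess:
  assumes "continuous_on UNIV e" "\<And>t. \<bar>e t - guess t\<bar> \<le> 1/20"
  shows "\<bar>profile_map e t - guess t\<bar> \<le> 1/20"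
proof -
  define c s where "c = cos (3*t)" and "s = sin (3*t)"
  have cs: "c^2 + s^2 = 1" by (simp add: c_def s_def)
  have t: "tube (green e t) (green' e t) c s" using green_tube[OF assms] by (simp add: c_def s_def)
  have "\<bar>profile_map e t - (force (1918/1000 + 53/1000 * c) (- 159/1000 * s) c s + 5/4 * (1918/1000 + 53/1000 * c))\<bar>
    \<le> 132/100 * \<bar>green e t - (1918/1000 + 53/1000 * c)\<bar> + 26/100 * \<bar>green' e t - - 159/1000 * s\<bar>"
    using force_lipschitz[OF t tube_center[OF cs]] by (simp add: profile_map_def c_def s_def)
  moreover have "\<bar>green e t - (1918/1000 + 53/1000 * c)\<bar> \<le> 235/10000" "\<bar>green' e t - - 159/1000 * s\<bar> \<le> 4/100"
    using t by (simp_all add: tube_def)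
  moreover note force_residual[OF cs]
  moreover have "guess t = 43155/10000 - 35775/100000 * c + 3/100*(2*c^2-1)"
    by (simp add: guess_def c_def)
  moreover have "\<bar>w - z\<bar> \<le> 1/20" if "\<bar>w - y\<bar> \<le> 132/100 * \<bar>u\<bar> + 26/100 * \<bar>v\<bar>" "\<bar>u\<bar> \<le> 235/10000" "\<bar>v\<bar> \<le> 4/100"
    "\<bar>y - z\<bar> \<le> 7/1000" for u v w y z :: real
    using that by argo
  ultimately show ?thesis by presburger
qed

lemma profile_map_contraction:
  assumes e: "continuous_on UNIV e" "\<And>t. \<bar>e t - guess t\<bar> \<le> 1/20"
    and h: "continuous_on UNIV h" "\<And>t. \<bar>h t - guess t\<bar> \<le> 1/20"
    and d: "\<And>t. \<bar>e t - h t\<bar> \<le> d"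
  shows "\<bar>profile_map e t - profile_map h t\<bar> \<le> 4/5 * d"
proof -
  have c: "continuous_on UNIV (\<lambda>t. e t - h t)" by (intro continuous_on_diff e h)
  have "\<bar>green e t - green h t\<bar> \<le> 4/9 * d"
    using green_bound[OF c d, of t] by (simp add: green_diff[OF e(1) h(1)])
  moreover have "\<bar>green' e t - green' h t\<bar> \<le> 2/3 * d"
    using green'_bound[OF c d, of t] by (simp add: green'_diff[OF e(1) h(1)])
  moreover have "0 \<le> d" using d[of 0] by linarith
  ultimately show ?thesis
    using force_lipschitz[OF green_tube[OF e] green_tube[OF h], of t] unfolding profile_map_def by argo
qed

lemma force_continuous_on:
  assumes "continuous_on S g" "continuous_on S p" "continuous_on S c" "continuous_on S s"
    and "\<And>x. x \<in> S \<Longrightarrow> denom (g x) (c x) \<noteq> 0"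
  shows "continuous_on S (\<lambda>x. force (g x) (p x) (c x) (s x))"
proof -
  have "1 + 2 * g x ^ 2 \<noteq> 0" for x
    using zero_le_power2[of "g x"] by linarith
  then show ?thesis
    unfolding force_def numer_def denom_def
    using assms(5) by (intro continuous_intros assms(1-4)) (auto simp: denom_def)
qed

lemma green_periodic:
  assumes "\<And>t. f (t + 2*pi/3) = f t"
  shows "green f (x + 2*pi/3) = green f x" "green' f (x + 2*pi/3) = green' f x"
proof -
  have shift: "integral {x + 2*pi/3 - 2*pi/3..x + 2*pi/3} (\<lambda>t. k (3/2*(x + 2*pi/3 - t)) * f t) =
    integral {x - 2*pi/3..x} (\<lambda>t. k (3/2*(x-t)) * f t)" for k :: "real \<Rightarrow> real"
    using integral_shift_Icc_real[of "x - 2*pi/3" x "\<lambda>t. k (3/2*(x + 2*pi/3 - t)) * f t" "2*pi/3"]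
    by (simp add: o_def add.commute[of "2*pi/3"] assms)
  show "green f (x + 2*pi/3) = green f x" "green' f (x + 2*pi/3) = green' f x"
    unfolding green_def green'_def shift by simp_all
qed

text \<open>Periodicity and closeness to \<open>guess\<close> are closed conditions on bounded
  continuous functions, since evaluation at a point is continuous. Periodicity is kept as part of
  the set because the differentiation rules for \<open>green\<close> depend on it.\<close>

lemma profile_map_fixed_point:
  obtains e where "continuous_on UNIV e" "\<And>t. e (t + 2*pi/3) = e t" "\<And>t. \<bar>e t - guess t\<bar> \<le> 1/20"
    "\<And>t. profile_map e t = e t"
proof -
  define S :: "(real \<Rightarrow>\<^sub>C real) set"
    where "S = {e. \<forall>t. apply_bcontfun e (t + 2*pi/3) = apply_bcontfun e t} \<inter>
      {e. \<forall>t. \<bar>apply_bcontfun e t - guess t\<bar> \<le> 1/20}"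
  \<comment> \<open>\<open>Bcontfun\<close> is meaningful only on bounded continuous functions; that
    \<open>profile_map e\<close> is one is shown for \<open>e\<close> in \<open>S\<close>, where
    alone \<open>T\<close> is iterated.\<close>
  define T :: "(real \<Rightarrow>\<^sub>C real) \<Rightarrow> (real \<Rightarrow>\<^sub>C real)" where "T e = Bcontfun (profile_map e)" for e
  have S: "e (t + 2*pi/3) = e t" "\<bar>e t - guess t\<bar> \<le> 1/20" if "e \<in> S" for e t
    using that by (auto simp: S_def)
  have guess_bounded: "\<bar>guess t\<bar> \<le> 5" for t
  proof -
    have "\<bar>cos (3*t)\<bar> \<le> 1" "0 \<le> cos (3*t)^2" "cos (3*t)^2 \<le> 1" by (simp_all add: abs_square_le_1)
    then show ?thesis unfolding guess_def by argo
  qed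
  have T: "apply_bcontfun (T e) = profile_map e" if e: "e \<in> S" for e
    unfolding T_def
  proof (rule Bcontfun_inverse, rule bcontfun_normI)
    have tube: "tube (green e t) (green' e t) (cos (3*t)) (sin (3*t))" for t
      by (rule green_tube) (use S[OF e] in auto)
    have "isCont (green e) t" "isCont (green' e) t" for t
      using green_has_derivative[of e t] green'_has_derivative[of e t] S(1)[OF e]
      by (auto intro: DERIV_isCont)
    then have "continuous_on UNIV (green e)" "continuous_on UNIV (green' e)"
      by (simp_all add: continuous_on_eq_continuous_at)
    moreover have "denom (green e t) (cos (3*t)) \<noteq> 0" for t
      using tube_den_lower[OF tube[of t]] by linarith
    ultimately show "continuous_on UNIV (profile_map e)"
      unfolding profile_map_def[abs_def]
      by (intro continuous_on_add continuous_on_mult force_continuous_on continuous_intros) auto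
    show "norm (profile_map e t) \<le> 6" for t
    proof -
      have "\<bar>profile_map e t - guess t\<bar> \<le> 1/20"
        by (rule profile_map_near_guess) (use S(2)[OF e] in auto)
      with guess_bounded[of t] show ?thesis unfolding real_norm_def by argo
    qed
  qed
  have cont: "continuous_on UNIV (\<lambda>e::real \<Rightarrow>\<^sub>C real. apply_bcontfun e t)" for t
  proof (rule continuous_onI)
    fix e :: "real \<Rightarrow>\<^sub>C real" and r :: real
    assume "0 < r"
    then show "\<exists>d>0. \<forall>f\<in>UNIV. dist f e < d \<longrightarrow> dist (apply_bcontfun f t) (apply_bcontfun e t) \<le> r"
      by (intro exI[of _ r]) (auto intro: order_trans[OF dist_bounded])
  qed
  have "closed S"
    unfolding S_def
    by (intro closed_Int closed_Collect_all closed_Collect_eq closed_Collect_le continuous_intros cont)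
  then have "complete S" by (simp add: complete_eq_closed)
  moreover have "S \<noteq> {}"
  proof -
    have "apply_bcontfun (Bcontfun guess) = guess"
      using guess_bounded by (intro Bcontfun_inverse bcontfun_normI[where b = 5] continuous_guess) auto
    moreover have "guess (t + 2*pi/3) = guess t" for t
      unfolding guess_def trig_periodic by simp
    ultimately have "Bcontfun guess \<in> S" by (simp add: S_def)
    then show ?thesis by blast
  qed
  moreover have "T ` S \<subseteq> S"
  proof safe
    fix e assume e: "e \<in> S"
    have "profile_map e (t + 2*pi/3) = profile_map e t" for t
      unfolding profile_map_def green_periodic(1)[of e, OF S(1)[OF e]] green_periodic(2)[of e, OF S(1)[OF e]] trig_periodic by simp
    then show "T e \<in> S"
      using profile_map_near_guess[of e] S(2)[OF e] by (simp add: S_def T[OF e])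
  qed
  moreover have "\<forall>e\<in>S. \<forall>h\<in>S. dist (T e) (T h) \<le> 4/5 * dist e h"
  proof (intro ballI dist_bound)
    fix e h t assume e: "e \<in> S" and h: "h \<in> S"
    show "dist (T e t) (T h t) \<le> 4/5 * dist e h"
      unfolding T[OF e] T[OF h] dist_real_def
      by (rule profile_map_contraction)
        (use S(2)[OF e] S(2)[OF h] dist_bounded[of e _ h] in \<open>auto simp: dist_real_def\<close>)
  qed
  ultimately obtain e where e: "e \<in> S" "T e = e"
    using Banach_fix[of S "4/5" T] by auto
  show ?thesis
    using that[of e] S[OF e(1)] T[OF e(1)] e(2) by simp
qed

text \<open>The fixed point is only continuous, but its Green image has two derivatives, the second
  being e - 9/4 g; the fixed-point equation then becomes the differential equation.\<close>

lemma profile_exists: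
  obtains g p :: "real \<Rightarrow> real"
  where "\<And>t. (g has_real_derivative p t) (at t)"
    "\<And>t. (p has_real_derivative force (g t) (p t) (cos (3*t)) (sin (3*t)) - g t) (at t)"
    "\<And>t. g (t + 2*pi/3) = g t" "\<And>t. tube (g t) (p t) (cos (3*t)) (sin (3*t))"
proof -
  obtain e where e: "continuous_on UNIV e" "\<And>t. e (t + 2*pi/3) = e t" "\<And>t. \<bar>e t - guess t\<bar> \<le> 1/20"
    "\<And>t. profile_map e t = e t"
    by (rule profile_map_fixed_point) blast
  show ?thesis
  proof (rule that)
    fix t
    show "(green e has_real_derivative green' e t) (at t)"
      by (rule green_has_derivative[OF e(1,2)])
    have "e t - 9/4 * green e t = force (green e t) (green' e t) (cos (3*t)) (sin (3*t)) - green e t"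
      using e(4)[of t] by (simp add: profile_map_def)
    then show "(green' e has_real_derivative force (green e t) (green' e t) (cos (3*t)) (sin (3*t)) - green e t) (at t)"
      using green'_has_derivative[OF e(1,2), of t] by simp
    show "green e (t + 2*pi/3) = green e t" using e(2) by (rule green_periodic)
    show "tube (green e t) (green' e t) (cos (3*t)) (sin (3*t))" by (rule green_tube[OF e(1,3)])
  qed
qed

section \<open>Algebras of functions closed under differentiation\<close>

text \<open>Smoothness is read off from closure under differentiation: if the derivative of each generator is a polynomial
  in generators, then so are all iterated partial derivatives of polynomials in generators.\<close>

inductive_set coordinate_algebra :: "(real \<Rightarrow> real) set \<Rightarrow> (real^'n::finite \<Rightarrow> real) set"
  for G :: "(real \<Rightarrow> real) set" where
  const: "(\<lambda>t. c) \<in> coordinate_algebra G"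
| gen: "h \<in> G \<Longrightarrow> (\<lambda>t. h (t $ j)) \<in> coordinate_algebra G"
| add: "a \<in> coordinate_algebra G \<Longrightarrow> b \<in> coordinate_algebra G \<Longrightarrow> (\<lambda>t. a t + b t) \<in> coordinate_algebra G"
| mult: "a \<in> coordinate_algebra G \<Longrightarrow> b \<in> coordinate_algebra G \<Longrightarrow> (\<lambda>t. a t * b t) \<in> coordinate_algebra G"

lemma coordinate_algebra_diff:
  "a \<in> coordinate_algebra G \<Longrightarrow> b \<in> coordinate_algebra G \<Longrightarrow> (\<lambda>t. a t - b t) \<in> coordinate_algebra G"
  using coordinate_algebra.add[OF _ coordinate_algebra.mult[OF coordinate_algebra.const[of "-1"]], of a G b] by simp

lemma coordinate_algebra_uminus:
  "a \<in> coordinate_algebra G \<Longrightarrow> (\<lambda>t. - a t) \<in> coordinate_algebra G"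
  using coordinate_algebra.mult[OF coordinate_algebra.const[of "-1"], of a G] by simp

lemma coordinate_algebra_power:
  "a \<in> coordinate_algebra G \<Longrightarrow> (\<lambda>t. a t ^ n) \<in> coordinate_algebra G"
  by (induction n) (auto intro: coordinate_algebra.intros)

lemmas coordinate_algebra_intros =
  coordinate_algebra.const coordinate_algebra.add coordinate_algebra.mult coordinate_algebra_diff coordinate_algebra_uminus coordinate_algebra_power

text \<open>The \<open>itself\<close> argument fixes the number of coordinates, in which
  \<open>coordinate_algebra\<close> is polymorphic.\<close>

definition closed_under_derivative :: "(real \<Rightarrow> real) set \<Rightarrow> 'n::finite itself \<Rightarrow> bool" where
  "closed_under_derivative G _ \<longleftrightarrow> (\<forall>h\<in>G. \<exists>h'. (\<forall>x. (h has_real_derivative h' x) (at x)) \<and>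
     (\<forall>j::'n. (\<lambda>t::real^'n. h' (t $ j)) \<in> coordinate_algebra G))"

lemma coordinate_algebra_has_derivative:
  fixes a :: "real^'n::finite \<Rightarrow> real"
  assumes G: "closed_under_derivative G TYPE('n)" and "a \<in> coordinate_algebra G"
  shows "\<exists>D. (\<forall>x. (a has_derivative D x) (at x)) \<and> (\<forall>v. (\<lambda>x. D x v) \<in> coordinate_algebra G)"
  using assms(2)
proof induction
  case (const c)
  show ?case
    by (rule exI[of _ "\<lambda>x v. 0"]) (auto intro: coordinate_algebra.const)
next
  case (gen h j)
  with G obtain h' where h': "\<And>x. (h has_real_derivative h' x) (at x)"
    "(\<lambda>t::real^'n. h' (t $ j)) \<in> coordinate_algebra G"
    unfolding closed_under_derivative_def by blast
  have "((\<lambda>t. h (t $ j)) has_derivative (\<lambda>v. h' (x $ j) * (v $ j))) (at x)" for x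
    using has_derivative_compose[OF bounded_linear_imp_has_derivative[OF bounded_linear_vec_nth]
        has_field_derivative_imp_has_derivative[OF h'(1)], of j x UNIV] by simp
  then show ?case
    using h'(2) by (intro exI[of _ "\<lambda>x v. h' (x $ j) * (v $ j)"]) (auto intro: coordinate_algebra.intros)
next
  case (add a b)
  then obtain A B where
    "\<And>x. (a has_derivative A x) (at x)" "\<And>v. (\<lambda>x. A x v) \<in> coordinate_algebra G"
    "\<And>x. (b has_derivative B x) (at x)" "\<And>v. (\<lambda>x. B x v) \<in> coordinate_algebra G"
    by blast
  then show ?case
    by (intro exI[of _ "\<lambda>x v. A x v + B x v"]) (auto intro: coordinate_algebra.intros has_derivative_add)
next
  case (mult a b)
  then obtain A B where
    "\<And>x. (a has_derivative A x) (at x)" "\<And>v. (\<lambda>x. A x v) \<in> coordinate_algebra G"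
    "\<And>x. (b has_derivative B x) (at x)" "\<And>v. (\<lambda>x. B x v) \<in> coordinate_algebra G"
    by blast
  with mult.hyps show ?case
    by (intro exI[of _ "\<lambda>x v. a x * B x v + A x v * b x"] conjI allI coordinate_algebra.add coordinate_algebra.mult
        has_derivative_mult) auto
qed

lemma coordinate_algebra_smooth_on:
  fixes f :: "real^'n::finite \<Rightarrow> real^'m::finite"
  assumes G: "closed_under_derivative G TYPE('n)" and "\<And>i. (\<lambda>x. f x $ i) \<in> coordinate_algebra G"
  shows "smooth_on f S"
proof -
  have "Ck_on k f S" for k
    using assms(2)
  proof (induction k arbitrary: f)
    case (0 f)
    have "isCont (\<lambda>x. f x $ i) x" for i x
      using coordinate_algebra_has_derivative[OF G 0] has_derivative_continuous by blast
    then have "isCont (\<lambda>x. \<chi> i. f x $ i) x" for x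
      unfolding isCont_def by (intro tendsto_vec_lambda) auto
    then show ?case by (simp add: continuous_at_imp_continuous_on)
  next
    case (Suc k f)
    from coordinate_algebra_has_derivative[OF G Suc.prems]
    obtain D where D: "\<And>i x. ((\<lambda>x. f x $ i) has_derivative D i x) (at x)"
      "\<And>i v. (\<lambda>x. D i x v) \<in> coordinate_algebra G"
      by metis
    have f: "(f has_derivative (\<lambda>v. \<chi> i. D i x v)) (at x)" for x
    proof -
      have "((\<lambda>x. f x \<bullet> b) has_derivative (\<lambda>v. (\<chi> i. D i x v) \<bullet> b)) (at x)" if "b \<in> Basis" for b
        using that D(1) by (auto simp: Basis_vec_def inner_axis)
      then show ?thesis using has_derivative_componentwise_within by blast
    qed
    then have "frechet_derivative f (at x) = (\<lambda>v. \<chi> i. D i x v)" for x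
      by (metis frechet_derivative_at)
    moreover have "Ck_on k (\<lambda>x. \<chi> i. D i x v) S" for v
      by (rule Suc.IH) (simp add: D(2))
    ultimately show ?case
      using f by (auto simp: differentiable_def)
  qed
  then show ?thesis by (simp add: smooth_on_def)
qed

section \<open>Curvature of torus-invariant hypersurfaces\<close>

lemma exhaust_6:
  fixes x :: 6
  shows "x = 1 \<or> x = 2 \<or> x = 3 \<or> x = 4 \<or> x = 5 \<or> x = 6"
proof (induct x)
  case (of_int z)
  then have "z = 0 \<or> z = 1 \<or> z = 2 \<or> z = 3 \<or> z = 4 \<or> z = 5" by fastforce
  then show ?case by auto
qed

lemma UNIV_6: "UNIV = {1, 2, 3, 4, 5, 6::6}"
  using exhaust_6 by auto

lemma forall_6: "(\<forall>i::6. P i) \<longleftrightarrow> P 1 \<and> P 2 \<and> P 3 \<and> P 4 \<and> P 5 \<and> P 6"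
  by (metis exhaust_6)

lemma sum_6: "sum f (UNIV::6 set) = f 1 + f 2 + f 3 + f 4 + f 5 + f 6"
  unfolding UNIV_6 by (simp add: ac_simps)

definition vec6 :: "complex \<Rightarrow> complex \<Rightarrow> complex \<Rightarrow> real^6" where
  "vec6 a b c = (\<chi> i. if i = 1 then Re a else if i = 2 then Im a else if i = 3 then Re b
     else if i = 4 then Im b else if i = 5 then Re c else Im c)"

lemma vec6_nth [simp]:
  "vec6 a b c $ 1 = Re a" "vec6 a b c $ 2 = Im a" "vec6 a b c $ 3 = Re b"
  "vec6 a b c $ 4 = Im b" "vec6 a b c $ 5 = Re c" "vec6 a b c $ 6 = Im c"
  by (simp_all add: vec6_def)

lemma vec6_cases:
  fixes v :: "real^6"
  obtains a b c where "v = vec6 a b c"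
proof
  show "v = vec6 (Complex (v$1) (v$2)) (Complex (v$3) (v$4)) (Complex (v$5) (v$6))"
    by (simp add: vec_eq_iff forall_6)
qed

lemma vec6_eq_iff: "vec6 a b c = vec6 a' b' c' \<longleftrightarrow> a = a' \<and> b = b' \<and> c = c'"
  by (auto simp: vec_eq_iff forall_6 complex_eq_iff)

lemma vec6_zero: "vec6 0 0 0 = 0"
  by (simp add: vec_eq_iff forall_6)

lemma inner_vec6: "vec6 a b c \<bullet> vec6 a' b' c' = a \<bullet> a' + b \<bullet> b' + c \<bullet> c'"
  by (simp add: inner_vec_def sum_6 inner_complex_def)

lemma norm_vec6: "norm (vec6 a b c) ^ 2 = norm a ^ 2 + norm b ^ 2 + norm c ^ 2"
  by (simp add: power2_norm_eq_inner inner_vec6)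

lemma bounded_linear_vec6: "bounded_linear (\<lambda>(a, b, c). vec6 a b c)"
  by (intro linear_conv_bounded_linear[THEN iffD1] linearI) (auto simp: vec_eq_iff forall_6)

lemma continuous_on_vec6 [continuous_intros]:
  assumes "continuous_on S a" "continuous_on S b" "continuous_on S c"
  shows "continuous_on S (\<lambda>x. vec6 (a x) (b x) (c x))"
  using bounded_linear.continuous_on[OF bounded_linear_vec6, of S "\<lambda>x. (a x, b x, c x)"] assms
  by (simp add: continuous_on_Pair)

lemma has_derivative_vec6:
  assumes "(a has_derivative a') (at x within S)" "(b has_derivative b') (at x within S)"
    "(c has_derivative c') (at x within S)"
  shows "((\<lambda>x. vec6 (a x) (b x) (c x)) has_derivative (\<lambda>v. vec6 (a' v) (b' v) (c' v))) (at x within S)"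
  using bounded_linear.has_derivative[OF bounded_linear_vec6
      has_derivative_Pair[OF assms(1) has_derivative_Pair[OF assms(2,3)]]] by simp

text \<open>The orbit of a curve with parameter \<open>t$4\<close> under the three rotations.
  Complex coefficients are allowed so that the family is closed under partial derivatives: an
  angular derivative multiplies one coefficient by the imaginary unit and annihilates the
  others.\<close>

definition wave :: "(real \<Rightarrow> complex) \<Rightarrow> (real \<Rightarrow> complex) \<Rightarrow> (real \<Rightarrow> complex) \<Rightarrow> real^4 \<Rightarrow> real^6" where
  "wave a b c t = vec6 (a (t$4) * cis (t$1)) (b (t$4) * cis (t$2)) (c (t$4) * cis (t$3))"

lemma wave_component_has_derivative:
  fixes t :: "real^4"
  assumes "\<And>s. (a has_vector_derivative a' s) (at s)"
  shows "((\<lambda>t. a (t$4) * cis (t$j)) has_derivative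
    (\<lambda>v. (v$4 *\<^sub>R a' (t$4) + v$j *\<^sub>R (\<i> * a (t$4))) * cis (t$j))) (at t)"
proof -
  have nth: "((\<lambda>t. t$k) has_derivative (\<lambda>v. v$k)) (at t)" for k
    by (rule bounded_linear_imp_has_derivative[OF bounded_linear_vec_nth])
  have "((\<lambda>t. a (t$4)) has_derivative (\<lambda>v. v$4 *\<^sub>R a' (t$4))) (at t)"
    by (rule has_derivative_compose[OF nth]) (use assms in \<open>simp add: has_vector_derivative_def\<close>)
  from has_derivative_mult[OF this has_derivative_cis[OF nth, of j]]
  show ?thesis by (simp add: algebra_simps)
qed

lemma wave_has_derivative:
  assumes "\<And>s. (a has_vector_derivative a' s) (at s)" "\<And>s. (b has_vector_derivative b' s) (at s)"
    "\<And>s. (c has_vector_derivative c' s) (at s)"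
  shows "(wave a b c has_derivative (\<lambda>v. vec6 ((v$4 *\<^sub>R a' (t$4) + v$1 *\<^sub>R (\<i> * a (t$4))) * cis (t$1))
     ((v$4 *\<^sub>R b' (t$4) + v$2 *\<^sub>R (\<i> * b (t$4))) * cis (t$2))
     ((v$4 *\<^sub>R c' (t$4) + v$3 *\<^sub>R (\<i> * c (t$4))) * cis (t$3)))) (at t)"
  unfolding wave_def[abs_def] by (intro has_derivative_vec6 wave_component_has_derivative assms)

lemma
  assumes "\<And>s. (a has_vector_derivative a' s) (at s)" "\<And>s. (b has_vector_derivative b' s) (at s)"
    "\<And>s. (c has_vector_derivative c' s) (at s)"
  shows partial_1_wave: "partial 1 (wave a b c) = wave (\<lambda>s. \<i> * a s) (\<lambda>s. 0) (\<lambda>s. 0)"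
    and partial_2_wave: "partial 2 (wave a b c) = wave (\<lambda>s. 0) (\<lambda>s. \<i> * b s) (\<lambda>s. 0)"
    and partial_3_wave: "partial 3 (wave a b c) = wave (\<lambda>s. 0) (\<lambda>s. 0) (\<lambda>s. \<i> * c s)"
    and partial_4_wave: "partial 4 (wave a b c) = wave a' b' c'"
  unfolding fun_eq_iff partial_def
    frechet_derivative_at[OF wave_has_derivative[of a a' b b' c c', OF assms], symmetric]
  by (simp_all add: wave_def axis_def)

lemma inner_mult_cis: "(a * cis x) \<bullet> (b * cis x) = a \<bullet> b"
proof -
  have "(a * cis x) \<bullet> (b * cis x) = (a \<bullet> b) * (cos x * cos x + sin x * sin x)"
    by (simp only: inner_complex_def times_complex.sel cis.sel algebra_simps)
  then show ?thesis by simp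
qed

lemma inner_wave: "wave a b c t \<bullet> wave a' b' c' t = a (t$4) \<bullet> a' (t$4) + b (t$4) \<bullet> b' (t$4) + c (t$4) \<bullet> c' (t$4)"
  by (simp add: wave_def inner_vec6 inner_mult_cis)

lemma matrix_inv_eqI:
  fixes A B :: "real^'n::finite^'n"
  assumes "A ** B = mat 1" "B ** A = mat 1"
  shows "matrix_inv A = B"
proof -
  have "A ** matrix_inv A = mat 1 \<and> matrix_inv A ** A = mat 1"
    unfolding matrix_inv_def by (rule someI[of _ B]) (use assms in simp)
  then show ?thesis
    by (metis assms(2) matrix_mul_assoc matrix_mul_lid matrix_mul_rid)
qed

lemma trace_matrix_inv_diagonal:
  fixes A :: "real^'n::finite^'n"
  assumes "\<And>i. d i \<noteq> 0"
  shows "trace (matrix_inv (\<chi> i j. if i = j then d i else 0) ** A) = (\<Sum>i\<in>UNIV. A$i$i / d i)"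
proof -
  have "matrix_inv (\<chi> i j. if i = j then d i else 0) = (\<chi> i j. if i = j then 1 / d i else 0)"
    by (rule matrix_inv_eqI)
      (auto simp: vec_eq_iff matrix_matrix_mult_def mat_def if_distrib[of "\<lambda>x. _ * x"] assms sum.delta cong: if_cong)
  then show ?thesis
    by (simp add: trace_def matrix_matrix_mult_def if_distrib[of "\<lambda>x. x * _"] sum.delta cong: if_cong)
qed

text \<open>The coordinate directions are orthogonal, with squared lengths the three squared radii
  and the squared speed, so the trace needs only the diagonal second derivatives. Differentiating
  twice along a circle of radius r gives a vector of length r pointing to its centre, hence the
  terms -n_k / r; the last term is the curvature of the profile.\<close>

lemma mean_curvature_wave:
  fixes \<gamma>1 \<gamma>2 \<gamma>3 \<gamma>1' \<gamma>2' \<gamma>3' \<gamma>1'' \<gamma>2'' \<gamma>3'' :: "real \<Rightarrow> real"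
  assumes d1: "\<And>s. (\<gamma>1 has_real_derivative \<gamma>1' s) (at s)" "\<And>s. (\<gamma>2 has_real_derivative \<gamma>2' s) (at s)"
      "\<And>s. (\<gamma>3 has_real_derivative \<gamma>3' s) (at s)"
    and d2: "\<And>s. (\<gamma>1' has_real_derivative \<gamma>1'' s) (at s)" "\<And>s. (\<gamma>2' has_real_derivative \<gamma>2'' s) (at s)"
      "\<And>s. (\<gamma>3' has_real_derivative \<gamma>3'' s) (at s)"
    and nonzero: "\<gamma>1 (t$4) \<noteq> 0" "\<gamma>2 (t$4) \<noteq> 0" "\<gamma>3 (t$4) \<noteq> 0"
      "\<gamma>1' (t$4) ^ 2 + \<gamma>2' (t$4) ^ 2 + \<gamma>3' (t$4) ^ 2 \<noteq> 0"
    and X: "X = wave (\<lambda>s. of_real (\<gamma>1 s)) (\<lambda>s. of_real (\<gamma>2 s)) (\<lambda>s. of_real (\<gamma>3 s))"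
    and \<nu>: "unit_normal X t \<nu>"
  obtains n1 n2 n3 where
    "\<gamma>1 (t$4) * n1 + \<gamma>2 (t$4) * n2 + \<gamma>3 (t$4) * n3 = 0"
    "\<gamma>1' (t$4) * n1 + \<gamma>2' (t$4) * n2 + \<gamma>3' (t$4) * n3 = 0"
    "mean_curvature X t \<nu> = - (n1 / \<gamma>1 (t$4) + n2 / \<gamma>2 (t$4) + n3 / \<gamma>3 (t$4)) +
      (\<gamma>1'' (t$4) * n1 + \<gamma>2'' (t$4) * n2 + \<gamma>3'' (t$4) * n3) / (\<gamma>1' (t$4) ^ 2 + \<gamma>2' (t$4) ^ 2 + \<gamma>3' (t$4) ^ 2)"
proof -
  obtain w1 w2 w3 where w: "\<nu> = vec6 w1 w2 w3" by (rule vec6_cases)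
  \<comment> \<open>The radial components of the normal; the diagonal second derivatives are all
    radial, so they see nothing else of it.\<close>
  define n1 n2 n3 where "n1 = cis (t$1) \<bullet> w1" and "n2 = cis (t$2) \<bullet> w2" and "n3 = cis (t$3) \<bullet> w3"
  have wn: "wave (\<lambda>s. of_real (a1 s)) (\<lambda>s. of_real (a2 s)) (\<lambda>s. of_real (a3 s)) t \<bullet> \<nu> =
    a1 (t$4) * n1 + a2 (t$4) * n2 + a3 (t$4) * n3" for a1 a2 a3
    by (simp add: w wave_def inner_vec6 n1_def n2_def n3_def scaleR_conv_of_real[symmetric])
  note v1 = d1[THEN has_vector_derivative_of_real] and v2 = d2[THEN has_vector_derivative_of_real]
  have zero: "((\<lambda>s. 0) has_vector_derivative 0) (at s)" for s :: real by simp
  note iv = has_vector_derivative_mult_right[OF v1(1), of \<i>] has_vector_derivative_mult_right[OF v1(2), of \<i>]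
    has_vector_derivative_mult_right[OF v1(3), of \<i>]
  note p = partial_1_wave[OF v1] partial_2_wave[OF v1] partial_3_wave[OF v1] partial_4_wave[OF v1]
  define q where "q = \<gamma>1' (t$4) ^ 2 + \<gamma>2' (t$4) ^ 2 + \<gamma>3' (t$4) ^ 2"
  define d :: "4 \<Rightarrow> real" where "d i = (if i = 1 then \<gamma>1 (t$4) ^ 2 else if i = 2 then \<gamma>2 (t$4) ^ 2
    else if i = 3 then \<gamma>3 (t$4) ^ 2 else q)" for i
  have d: "d 1 = \<gamma>1 (t$4) ^ 2" "d 2 = \<gamma>2 (t$4) ^ 2" "d 3 = \<gamma>3 (t$4) ^ 2" "d 4 = q"
    by (simp_all add: d_def)
  have I: "first_fundamental_form X t = (\<chi> i j. if i = j then d i else 0)"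
    unfolding first_fundamental_form_def X vec_eq_iff forall_4
    by (simp add: p inner_wave d inner_complex_def power2_eq_square q_def)
  have pp: "partial 1 (partial 1 X) t \<bullet> \<nu> = - \<gamma>1 (t$4) * n1" "partial 2 (partial 2 X) t \<bullet> \<nu> = - \<gamma>2 (t$4) * n2"
    "partial 3 (partial 3 X) t \<bullet> \<nu> = - \<gamma>3 (t$4) * n3"
    "partial 4 (partial 4 X) t \<bullet> \<nu> = \<gamma>1'' (t$4) * n1 + \<gamma>2'' (t$4) * n2 + \<gamma>3'' (t$4) * n3"
    using wn[of "\<lambda>s. - \<gamma>1 s" "\<lambda>s. 0" "\<lambda>s. 0"] wn[of "\<lambda>s. 0" "\<lambda>s. - \<gamma>2 s" "\<lambda>s. 0"]
      wn[of "\<lambda>s. 0" "\<lambda>s. 0" "\<lambda>s. - \<gamma>3 s"] wn[of \<gamma>1'' \<gamma>2'' \<gamma>3'']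
    unfolding X p partial_1_wave[OF iv(1) zero zero] partial_2_wave[OF zero iv(2) zero]
      partial_3_wave[OF zero zero iv(3)] partial_4_wave[OF v2]
    by (simp_all add: mult.assoc[symmetric])
  have "mean_curvature X t \<nu> = (\<Sum>i\<in>UNIV. (partial i (partial i X) t \<bullet> \<nu>) / d i)"
    unfolding mean_curvature_def I
    by (subst trace_matrix_inv_diagonal)
      (use nonzero exhaust_4 in \<open>auto simp: d_def q_def second_fundamental_form_def\<close>)
  also have "\<dots> = - (n1 / \<gamma>1 (t$4) + n2 / \<gamma>2 (t$4) + n3 / \<gamma>3 (t$4)) +
      (\<gamma>1'' (t$4) * n1 + \<gamma>2'' (t$4) * n2 + \<gamma>3'' (t$4) * n3) / q"
    unfolding sum_4 pp d using nonzero by (simp add: power2_eq_square)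
  finally have H: "mean_curvature X t \<nu> = - (n1 / \<gamma>1 (t$4) + n2 / \<gamma>2 (t$4) + n3 / \<gamma>3 (t$4)) +
      (\<gamma>1'' (t$4) * n1 + \<gamma>2'' (t$4) * n2 + \<gamma>3'' (t$4) * n3) / q" .
  have "X t \<bullet> \<nu> = 0" "partial 4 X t \<bullet> \<nu> = 0" using \<nu> by (auto simp: unit_normal_def)
  then show ?thesis
    using that[of n1 n2 n3] H wn[of \<gamma>1 \<gamma>2 \<gamma>3] wn[of \<gamma>1' \<gamma>2' \<gamma>3'] by (simp add: X p q_def)
qed

text \<open>After division by the phase, the real part of each complex component of the differential
  is the motion along the profile and the imaginary part the rotation, so the two kinds of kernel
  equations separate.\<close>

lemma wave_immersive:
  fixes \<gamma>1 \<gamma>2 \<gamma>3 \<gamma>1' \<gamma>2' \<gamma>3' :: "real \<Rightarrow> real"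
  assumes d1: "\<And>s. (\<gamma>1 has_real_derivative \<gamma>1' s) (at s)" "\<And>s. (\<gamma>2 has_real_derivative \<gamma>2' s) (at s)"
      "\<And>s. (\<gamma>3 has_real_derivative \<gamma>3' s) (at s)"
    and nonzero: "\<gamma>1 (t$4) \<noteq> 0" "\<gamma>2 (t$4) \<noteq> 0" "\<gamma>3 (t$4) \<noteq> 0"
      "\<gamma>1' (t$4) ^ 2 + \<gamma>2' (t$4) ^ 2 + \<gamma>3' (t$4) ^ 2 \<noteq> 0"
    and X: "X = wave (\<lambda>s. of_real (\<gamma>1 s)) (\<lambda>s. of_real (\<gamma>2 s)) (\<lambda>s. of_real (\<gamma>3 s))"
  shows "inj (frechet_derivative X (at t))"
proof -
  note v1 = d1[THEN has_vector_derivative_of_real]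
  note D = wave_has_derivative[OF v1, folded X, of t]
  note fd = frechet_derivative_at[OF D, symmetric]
  have "linear (frechet_derivative X (at t))"
    unfolding fd by (rule has_derivative_linear[OF D])
  moreover have "v = 0" if "frechet_derivative X (at t) v = 0" for v
  proof -
    have "\<gamma>1' (t$4) * v$4 = 0 \<and> \<gamma>1 (t$4) * v$1 = 0 \<and> \<gamma>2' (t$4) * v$4 = 0 \<and> \<gamma>2 (t$4) * v$2 = 0 \<and>
       \<gamma>3' (t$4) * v$4 = 0 \<and> \<gamma>3 (t$4) * v$3 = 0"
      using that unfolding fd vec6_zero[symmetric] vec6_eq_iff mult_eq_0_iff
      by (simp add: cis_neq_zero) (auto simp: complex_eq_iff)
    with nonzero have "v$1 = 0 \<and> v$2 = 0 \<and> v$3 = 0 \<and> v$4 = 0" by auto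
    then show ?thesis by (simp add: vec_eq_iff forall_4)
  qed
  ultimately show ?thesis by (simp add: linear_injective_0)
qed

section \<open>Algebra of three equally spaced points on the circle\<close>

lemma trig_third_turn:
  "cos (s + 2*pi/3) = - cos s / 2 - sqrt 3 / 2 * sin s" "sin (s + 2*pi/3) = - sin s / 2 + sqrt 3 / 2 * cos s"
  "cos (s + 4*pi/3) = - cos s / 2 + sqrt 3 / 2 * sin s" "sin (s + 4*pi/3) = - sin s / 2 - sqrt 3 / 2 * cos s"
proof -
  have *: "2*pi/3 = pi - pi/3" "4*pi/3 = pi + pi/3" by simp_all
  show "cos (s + 2*pi/3) = - cos s / 2 - sqrt 3 / 2 * sin s" "sin (s + 2*pi/3) = - sin s / 2 + sqrt 3 / 2 * cos s"
  "cos (s + 4*pi/3) = - cos s / 2 + sqrt 3 / 2 * sin s" "sin (s + 4*pi/3) = - sin s / 2 - sqrt 3 / 2 * cos s"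
    unfolding * cos_add sin_add cos_diff sin_diff by (simp_all add: cos_60 sin_60)
qed

text \<open>Three points \<open>(C\<^sub>k, S\<^sub>k)\<close> at equal distances on the unit circle.\<close>

lemma third_turn:
  fixes C S C2 C3 S2 S3 :: real
  assumes CS: "C^2 + S^2 = 1"
    and eqs: "C2 = - C / 2 - sqrt 3 / 2 * S" "S2 = - S / 2 + sqrt 3 / 2 * C"
      "C3 = - C / 2 + sqrt 3 / 2 * S" "S3 = - S / 2 - sqrt 3 / 2 * C"
  shows third_turn_sums: "C + C2 + C3 = 0" "S + S2 + S3 = 0"
      "C^2 + C2^2 + C3^2 = 3/2" "S^2 + S2^2 + S3^2 = 3/2" "C * S + C2 * S2 + C3 * S3 = 0"
      "C^3 + C2^3 + C3^3 = 3/4 * (4*C^3 - 3*C)"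
      "S * C^2 + S2 * C2^2 + S3 * C3^2 = 3/4 * (3 * S - 4 * S^3)"
    and third_turn_products: "C2 * C3 = C^2 - 3/4" "C * C3 = C2^2 - 3/4" "C * C2 = C3^2 - 3/4"
    and third_turn_inner: "C * C2 + S * S2 = -1/2" "C * C3 + S * S3 = -1/2" "C2 * C3 + S2 * S3 = -1/2"
      "C2^2 + S2^2 = 1" "C3^2 + S3^2 = 1"
proof -
  define x where "x = sqrt 3 / 2"
  have CC: "C*C = 1 - S * S" using CS by (simp add: power2_eq_square)
  have xx: "x * x = 3/4" by (simp add: x_def)
  have xxa: "x * (x * y) = 3/4 * y" for y using xx by (metis mult.assoc)
  \<comment> \<open>Halving clears the fractions from all six coordinates; the identities then
    follow by rewriting with x^2 = 3/4 and c^2 = 1/4 - s^2 to a normal form.\<close>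
  define c s where "c = C / 2" and "s = S / 2"
  have eqs': "C = 2 * c" "S = 2 * s" "C2 = - c - 2 * (x * s)" "S2 = - s + 2 * (x * c)" "C3 = - c + 2 * (x * s)" "S3 = - s - 2 * (x * c)"
    by (simp_all add: eqs x_def c_def s_def)
  have cc: "c * c = 1/4 - s * s" using CC by (simp add: eqs')
  have cca: "c * (c * y) = 1/4 * y - s * (s * y)" for y
    using cc by (metis left_diff_distrib mult.assoc)
  note rules = algebra_simps power2_eq_square power3_eq_cube xx xxa cc cca
  show "C + C2 + C3 = 0" "S + S2 + S3 = 0"
      "C^2 + C2^2 + C3^2 = 3/2" "S^2 + S2^2 + S3^2 = 3/2" "C * S + C2 * S2 + C3 * S3 = 0"
      "C^3 + C2^3 + C3^3 = 3/4 * (4*C^3 - 3*C)"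
      "S * C^2 + S2 * C2^2 + S3 * C3^2 = 3/4 * (3 * S - 4 * S^3)"
    "C2 * C3 = C^2 - 3/4" "C * C3 = C2^2 - 3/4" "C * C2 = C3^2 - 3/4"
     "C * C2 + S * S2 = -1/2" "C * C3 + S * S3 = -1/2" "C2 * C3 + S2 * S3 = -1/2"
      "C2^2 + S2^2 = 1" "C3^2 + S3^2 = 1"
    unfolding eqs' by (simp_all add: rules)
qed

context
  fixes C S C2 C3 S2 S3 :: real
  assumes CS: "C^2 + S^2 = 1"
    and eqs: "C2 = - C / 2 - sqrt 3 / 2 * S" "S2 = - S / 2 + sqrt 3 / 2 * C"
      "C3 = - C / 2 + sqrt 3 / 2 * S" "S3 = - S / 2 - sqrt 3 / 2 * C"
begin

text \<open>The vectors (C_k), (S_k) and (1, 1, 1) are pairwise orthogonal with squared lengths 3/2,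
  3/2 and 3. The vector with entries g + C_k is the unnormalised curve, and p - S_k is its
  derivative.\<close>

lemma third_turn_norms:
  "(g + C)^2 + (g + C2)^2 + (g + C3)^2 = 3*g^2 + 3/2"
  "(p - S)^2 + (p - S2)^2 + (p - S3)^2 = 3*p^2 + 3/2"
  "(g + C) * (p - S) + (g + C2) * (p - S2) + (g + C3) * (p - S3) = 3*g*p"
proof -
  note t = third_turn_sums[OF CS eqs]
  have "(g + C)^2 + (g + C2)^2 + (g + C3)^2 = 3*g^2 + 2*g*(C + C2 + C3) + (C^2 + C2^2 + C3^2)"
    by (simp add: power2_eq_square algebra_simps)
  then show "(g + C)^2 + (g + C2)^2 + (g + C3)^2 = 3*g^2 + 3/2" by (simp add: t)
  have "(p - S)^2 + (p - S2)^2 + (p - S3)^2 = 3*p^2 - 2*p*(S + S2 + S3) + (S^2 + S2^2 + S3^2)"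
    by (simp add: power2_eq_square algebra_simps)
  then show "(p - S)^2 + (p - S2)^2 + (p - S3)^2 = 3*p^2 + 3/2" by (simp add: t)
  have "(g + C) * (p - S) + (g + C2) * (p - S2) + (g + C3) * (p - S3) =
    3*g*p - g * (S + S2 + S3) + p * (C + C2 + C3) - (C * S + C2 * S2 + C3 * S3)"
    by (simp add: algebra_simps)
  then show "(g + C) * (p - S) + (g + C2) * (p - S2) + (g + C3) * (p - S3) = 3*g*p" by (simp add: t)
qed

text \<open>The three cosines are the roots of 4 x^3 - 3 x - cos 3s, with T_3 = 4 x^3 - 3 x the
  Chebyshev polynomial; evaluating at x = -g gives T_3(g) + cos 3s, which is
  \<open>denom\<close>.\<close>

lemma third_turn_product:
  "4 * ((g + C) * (g + C2) * (g + C3)) = 4*g^3 - 3*g + (4*C^3 - 3*C)"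
proof -
  note t = third_turn_sums[OF CS eqs] and q = third_turn_products[OF CS eqs]
  have "4 * ((g + C) * (g + C2) * (g + C3)) = 4*g^3 + 4*g^2 * (C + C2 + C3) +
    4*g*(C * C2 + C * C3 + C2 * C3) + 4 * C * (C2 * C3)"
    by (simp add: power2_eq_square power3_eq_cube algebra_simps)
  also have "C * C2 + C * C3 + C2 * C3 = - 3/4" unfolding q using t(3) by simp
  finally show ?thesis unfolding q t by (simp add: power2_eq_square power3_eq_cube algebra_simps)
qed

text \<open>The sum of normal component over ray component, cleared of denominators; the right-hand
  side is \<open>numer\<close>.\<close>

lemma third_turn_weighted:
  "2 * ((1 - 2*g*C + 2*p * S) * ((g + C2) * (g + C3)) + (1 - 2*g*C2 + 2*p * S2) * ((g + C) * (g + C3))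
    + (1 - 2*g*C3 + 2*p * S3) * ((g + C) * (g + C2))) = 12*g^2 - 3/2 - 3*g*(4*C^3 - 3*C) + 3*p*(3 * S - 4 * S^3)"
proof -
  note t = third_turn_sums[OF CS eqs] and q = third_turn_products[OF CS eqs]
  \<comment> \<open>The product of the other two factors becomes a quadratic in the remaining cosine
    alone, so that the sum reduces to the symmetric sums already known.\<close>
  have "(g + a) * (g + b) = g^2 - g * c + (c^2 - 3/4)" if "c + a + b = 0" "a * b = c^2 - 3/4" for a b c :: real
  proof -
    have "(g + a) * (g + b) = g^2 + g * (a + b) + a * b" by (simp add: power2_eq_square algebra_simps)
    also have "a + b = - c" using that(1) by simp
    finally show ?thesis by (simp add: that)
  qed
  from this[of C C2 C3] this[of C2 C C3] this[of C3 C C2]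
  have eq: "(g + C2) * (g + C3) = g^2 - g * C + (C^2 - 3/4)" "(g + C) * (g + C3) = g^2 - g * C2 + (C2^2 - 3/4)"
    "(g + C) * (g + C2) = g^2 - g * C3 + (C3^2 - 3/4)"
    using t(1) q by (simp_all add: add_ac)
  have "2 * ((1 - 2*g*C + 2*p * S) * ((g + C2) * (g + C3)) + (1 - 2*g*C2 + 2*p * S2) * ((g + C) * (g + C3))
    + (1 - 2*g*C3 + 2*p * S3) * ((g + C) * (g + C2))) =
    6*g^2 - 9/2 + (2 + 4*g^2) * (C^2 + C2^2 + C3^2) - 2*g*(1 + 2*g^2 - 3/2) * (C + C2 + C3)
      - 4*g*(C^3 + C2^3 + C3^3) + 4*p*(g^2 - 3/4) * (S + S2 + S3) - 4*p*g*(C * S + C2 * S2 + C3 * S3)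
      + 4*p*(S * C^2 + S2 * C2^2 + S3 * C3^2)"
    unfolding eq by (simp add: power2_eq_square power3_eq_cube algebra_simps)
  then show ?thesis unfolding t by (simp add: algebra_simps)
qed

text \<open>With a = g'', this pairs the normal direction with the second derivative of the
  unnormalised curve; it is the origin of g'' + g in the profile equation.\<close>

lemma third_turn_laplace:
  "(1 - 2*g*C + 2*p * S) * (a - C) + (1 - 2*g*C2 + 2*p * S2) * (a - C2) + (1 - 2*g*C3 + 2*p * S3) * (a - C3) = 3*a + 3*g"
proof -
  note t = third_turn_sums[OF CS eqs]
  have "(1 - 2*g*C + 2*p * S) * (a - C) + (1 - 2*g*C2 + 2*p * S2) * (a - C2) + (1 - 2*g*C3 + 2*p * S3) * (a - C3) =
    3*a - (1 + 2*g*a) * (C + C2 + C3) + 2*p*a*(S + S2 + S3) + 2*g*(C^2 + C2^2 + C3^2) - 2*p*(C * S + C2 * S2 + C3 * S3)"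
    by (simp add: power2_eq_square algebra_simps)
  then show ?thesis unfolding t by simp
qed

text \<open>In the orthogonal basis (1, 1, 1), (C_k), (S_k) the hypotheses express the coefficients
  along the last two vectors through the first: the inner products with (C_k) and (S_k) are -g l and
  p l, where l = n1 + n2 + n3.\<close>

lemma third_turn_normal:
  assumes n: "(g + C) * n1 + (g + C2) * n2 + (g + C3) * n3 = 0"
    "(p - S) * n1 + (p - S2) * n2 + (p - S3) * n3 = 0"
  shows "3 * n1 = (n1 + n2 + n3) * (1 - 2*g*C + 2*p * S)"
    "3 * n2 = (n1 + n2 + n3) * (1 - 2*g*C2 + 2*p * S2)"
    "3 * n3 = (n1 + n2 + n3) * (1 - 2*g*C3 + 2*p * S3)"
proof -
  note i = third_turn_inner[OF CS eqs]
  define l where "l = n1 + n2 + n3"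
  have c: "C * n1 + C2 * n2 + C3 * n3 = - (g * l)" and s: "S * n1 + S2 * n2 + S3 * n3 = p * l"
    using n by (simp_all add: l_def algebra_simps)
  have expand: "(a * C + b * S) * n1 + (a * C2 + b * S2) * n2 + (a * C3 + b * S3) * n3 = l * (- (a * g) + b * p)" for a b
  proof -
    have "(a * C + b * S) * n1 + (a * C2 + b * S2) * n2 + (a * C3 + b * S3) * n3 =
      a * (C * n1 + C2 * n2 + C3 * n3) + b * (S * n1 + S2 * n2 + S3 * n3)"
      by (simp add: algebra_simps)
    then show ?thesis unfolding c s by (simp add: algebra_simps)
  qed
  have i': "C2 * C + S2 * S = -1/2" "C3 * C + S3 * S = -1/2" "C3 * C2 + S3 * S2 = -1/2"
    "C * C + S * S = 1" "C2 * C2 + S2 * S2 = 1" "C3 * C3 + S3 * S3 = 1"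
    using i CS by (simp_all add: mult.commute power2_eq_square)
  have "n1 - n2 / 2 - n3 / 2 = l * (- (C * g) + S * p)" "n2 - n1 / 2 - n3 / 2 = l * (- (C2 * g) + S2 * p)"
    "n3 - n1 / 2 - n2 / 2 = l * (- (C3 * g) + S3 * p)"
    using expand[of C S] expand[of C2 S2] expand[of C3 S3] unfolding i i' by simp_all
  moreover have "3 * n1 = l + 2 * (n1 - n2 / 2 - n3 / 2)" "3 * n2 = l + 2 * (n2 - n1 / 2 - n3 / 2)"
    "3 * n3 = l + 2 * (n3 - n1 / 2 - n2 / 2)"
    by (simp_all add: l_def)
  ultimately show "3 * n1 = (n1 + n2 + n3) * (1 - 2*g*C + 2*p * S)"
    "3 * n2 = (n1 + n2 + n3) * (1 - 2*g*C2 + 2*p * S2)"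
    "3 * n3 = (n1 + n2 + n3) * (1 - 2*g*C3 + 2*p * S3)"
    unfolding l_def[symmetric] by (simp_all add: algebra_simps)
qed

end

section \<open>Speed and minimality of the normalised curve\<close>

context
  fixes C S C2 C3 S2 S3 g p m m' :: real
  assumes CS: "C^2 + S^2 = 1"
    and eqs: "C2 = - C / 2 - sqrt 3 / 2 * S" "S2 = - S / 2 + sqrt 3 / 2 * C"
      "C3 = - C / 2 + sqrt 3 / 2 * S" "S3 = - S / 2 - sqrt 3 / 2 * C"
    and m: "m \<noteq> 0" "m^2 * (3*g^2 + 3/2) = 1" and m': "m' = - 3 * g * p * m^3"
begin

text \<open>Here \<open>m\<close> is the factor that projects the curve to the unit sphere and
  \<open>m'\<close> its derivative. Projection removes the radial part of the velocity, leaving m^2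
  |V|^2 - m^4 (R . V)^2 for ray R and velocity V.\<close>

lemma speed_formula:
  "(m' * (g + C) + m * (p - S))^2 + (m' * (g + C2) + m * (p - S2))^2 + (m' * (g + C3) + m * (p - S3))^2
    = 9/4 * (1 + 2*g^2 + 2*p^2) * m^4"
proof -
  note norms = third_turn_norms[OF CS eqs]
  have "(m' * (g + C) + m * (p - S))^2 + (m' * (g + C2) + m * (p - S2))^2 + (m' * (g + C3) + m * (p - S3))^2
    = m'^2 * ((g + C)^2 + (g + C2)^2 + (g + C3)^2)
      + 2 * m * m' * ((g + C) * (p - S) + (g + C2) * (p - S2) + (g + C3) * (p - S3))
      + m^2 * ((p - S)^2 + (p - S2)^2 + (p - S3)^2)"
    by (simp add: power2_eq_square algebra_simps)
  also have "\<dots> = m'^2 * (3*g^2 + 3/2) + 2 * m * m' * (3*g*p) + m^2 * (3*p^2 + 3/2)"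
    by (simp only: norms)
  also have "\<dots> = 9 * g^2 * p^2 * m^4 * (m^2 * (3*g^2 + 3/2)) - 18 * g^2 * p^2 * m^4 + m^2 * (3*p^2 + 3/2)"
    by (simp add: m' eval_nat_numeral algebra_simps)
  \<comment> \<open>The normalisation is now used backwards: inserting the factor 1 makes both terms
    multiples of m^4, and g^2 p^2 cancels.\<close>
  also have "\<dots> = m^2 * (3*p^2 + 3/2) * (m^2 * (3*g^2 + 3/2)) - 9 * g^2 * p^2 * m^4"
    unfolding m(2) by simp
  also have "\<dots> = 9/4 * (1 + 2*g^2 + 2*p^2) * m^4"
    by (simp add: eval_nat_numeral algebra_simps)
  finally show ?thesis .
qed

text \<open>A vector orthogonal to \<open>(g + C\<^sub>k)\<close> and to \<open>(p - S\<^sub>k)\<close> is a multiple of \<open>(1 - 2 g C\<^sub>k + 2 p S\<^sub>k)\<close>.\<close>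

lemma minimality_equation:
  fixes a m'' n1 n2 n3 :: real
  assumes pos: "g + C \<noteq> 0" "g + C2 \<noteq> 0" "g + C3 \<noteq> 0"
    and a: "a = force g p (4*C^3 - 3*C) (3 * S - 4 * S^3) - g"
    and n: "m * (g + C) * n1 + m * (g + C2) * n2 + m * (g + C3) * n3 = 0"
      "(m' * (g + C) + m * (p - S)) * n1 + (m' * (g + C2) + m * (p - S2)) * n2
        + (m' * (g + C3) + m * (p - S3)) * n3 = 0"
  shows "- (n1 / (m * (g + C)) + n2 / (m * (g + C2)) + n3 / (m * (g + C3)))
    + ((m'' * (g + C) + 2 * m' * (p - S) + m * (a - C)) * n1 + (m'' * (g + C2) + 2 * m' * (p - S2) + m * (a - C2)) * n2
       + (m'' * (g + C3) + 2 * m' * (p - S3) + m * (a - C3)) * n3)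
     / ((m' * (g + C) + m * (p - S))^2 + (m' * (g + C2) + m * (p - S2))^2 + (m' * (g + C3) + m * (p - S3))^2) = 0"
proof -
  define l where "l = n1 + n2 + n3"
  define w1 w2 w3 where "w1 = 1 - 2*g*C + 2*p * S" and "w2 = 1 - 2*g*C2 + 2*p * S2" and "w3 = 1 - 2*g*C3 + 2*p * S3"
  define N where "N = numer g p (4*C^3 - 3*C) (3 * S - 4 * S^3)"
  define D where "D = denom g (4*C^3 - 3*C)"
  have "m * ((g + C) * n1 + (g + C2) * n2 + (g + C3) * n3) = 0"
    using n(1) by (simp add: algebra_simps)
  then have n1: "(g + C) * n1 + (g + C2) * n2 + (g + C3) * n3 = 0" using m by simp
  have "m' * ((g + C) * n1 + (g + C2) * n2 + (g + C3) * n3)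
      + m * ((p - S) * n1 + (p - S2) * n2 + (p - S3) * n3) = 0"
    using n(2) by (simp add: algebra_simps)
  then have n2: "(p - S) * n1 + (p - S2) * n2 + (p - S3) * n3 = 0" using m n1 by simp
  have w: "n1 = l/3 * w1" "n2 = l/3 * w2" "n3 = l/3 * w3"
    using third_turn_normal[OF CS eqs n1 n2] by (simp_all add: l_def w1_def w2_def w3_def)
  have D: "4 * ((g + C) * (g + C2) * (g + C3)) = D"
    using third_turn_product[OF CS eqs] by (simp add: D_def denom_def)
  have W: "2 * (w1 * ((g + C2) * (g + C3)) + w2 * ((g + C) * (g + C3)) + w3 * ((g + C) * (g + C2))) = N"
    using third_turn_weighted[OF CS eqs] by (simp add: N_def numer_def w1_def w2_def w3_def)
  have D0: "D \<noteq> 0" using pos unfolding D[symmetric] by simp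
  have sum_fractions: "u1 / x + u2 / y + u3 / z = (u1 * (y * z) + u2 * (x * z) + u3 * (x * y)) / (x * y * z)"
    if "x \<noteq> 0" "y \<noteq> 0" "z \<noteq> 0" for u1 u2 u3 x y z :: real
    using that by (simp add: field_simps)
  have half: "x = y / 2" if "2 * x = y" for x y :: real using that by simp
  from sum_fractions[OF pos] have "w1 / (g + C) + w2 / (g + C2) + w3 / (g + C3) =
    (w1 * ((g + C2) * (g + C3)) + w2 * ((g + C) * (g + C3)) + w3 * ((g + C) * (g + C2))) / ((g + C) * (g + C2) * (g + C3))" .
  also have "w1 * ((g + C2) * (g + C3)) + w2 * ((g + C) * (g + C3)) + w3 * ((g + C) * (g + C2)) = N / 2"
    using half[OF W] .
  also have "(g + C) * (g + C2) * (g + C3) = D / 4" using D by (metis nonzero_mult_div_cancel_left zero_neq_numeral)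
  also have "N / 2 / (D / 4) = 2 * N / D" by simp
  finally have WD: "w1 / (g + C) + w2 / (g + C2) + w3 / (g + C3) = 2 * N / D" .
  have "n1 / (m * (g + C)) + n2 / (m * (g + C2)) + n3 / (m * (g + C3)) =
    l / (3 * m) * (w1 / (g + C) + w2 / (g + C2) + w3 / (g + C3))"
    unfolding w by (simp add: algebra_simps)
  then have A: "n1 / (m * (g + C)) + n2 / (m * (g + C2)) + n3 / (m * (g + C3)) = 2/3 * (l * N / (m * D))"
    unfolding WD by simp
  have "(m'' * (g + C) + 2 * m' * (p - S) + m * (a - C)) * n1 + (m'' * (g + C2) + 2 * m' * (p - S2) + m * (a - C2)) * n2
       + (m'' * (g + C3) + 2 * m' * (p - S3) + m * (a - C3)) * n3 =
    m'' * ((g + C) * n1 + (g + C2) * n2 + (g + C3) * n3) + 2 * m' * ((p - S) * n1 + (p - S2) * n2 + (p - S3) * n3)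
    + m * ((a - C) * n1 + (a - C2) * n2 + (a - C3) * n3)"
    by (simp add: algebra_simps)
  \<comment> \<open>The derivatives of the scale multiply the two orthogonality relations and drop
    out, which is why \<open>m''\<close> can be an arbitrary number.\<close>
  also have "\<dots> = m * l / 3 * (w1 * (a - C) + w2 * (a - C2) + w3 * (a - C3))"
    unfolding n1 n2 unfolding w by (simp add: field_simps)
  also have "w1 * (a - C) + w2 * (a - C2) + w3 * (a - C3) = 3*a + 3*g"
    unfolding w1_def w2_def w3_def by (rule third_turn_laplace[OF CS eqs])
  also have "m * l / 3 * (3*a + 3*g) = m * l * ((1 + 2*g^2 + 2*p^2) / (1 + 2*g^2) * (N / D))"
    by (simp add: a force_def N_def D_def)
  finally have B: "(m'' * (g + C) + 2 * m' * (p - S) + m * (a - C)) * n1 + (m'' * (g + C2) + 2 * m' * (p - S2) + m * (a - C2)) * n2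
       + (m'' * (g + C3) + 2 * m' * (p - S3) + m * (a - C3)) * n3 =
     m * l * ((1 + 2*g^2 + 2*p^2) / (1 + 2*g^2) * (N / D))" .
  define K where "K = 1 + 2*g^2 + 2*p^2"
  have K: "K \<noteq> 0" and G: "1 + 2*g^2 \<noteq> 0"
    using zero_le_power2[of g] zero_le_power2[of p] unfolding K_def by linarith+
  \<comment> \<open>The normalisation again: it converts the denominator in \<open>force\<close>
    into the power of \<open>m\<close> that matches m^4 in the speed.\<close>
  have "1 + 2*g^2 = 2 / (3 * m^2)"
    using m by (simp add: field_simps)
  then have "m * l * (K / (1 + 2*g^2) * (N / D)) / (9/4 * K * m^4) = 2/3 * (l * N / (m * D))"
    using K m(1) D0 by (simp add: eval_nat_numeral mult.commute)
  then show ?thesis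
    unfolding A B speed_formula K_def[symmetric] by simp
qed

end

lemma triple_angle:
  "cos (3 * s) = 4 * cos s ^ 3 - 3 * cos (s::real)" "sin (3 * s) = 3 * sin s - 4 * sin s ^ 3"
proof -
  have *: "3 * s = 2 * s + s" by simp
  have c: "cos s * (cos s * x) = x - sin s * (sin s * x)" for x
    using sin_cos_squared_add3[of s] by (metis add_diff_cancel_right' left_diff_distrib mult.assoc mult_1)
  show "cos (3 * s) = 4 * cos s ^ 3 - 3 * cos s" "sin (3 * s) = 3 * sin s - 4 * sin s ^ 3"
    unfolding * cos_add sin_add cos_double sin_double
    by (simp_all add: power2_eq_square power3_eq_cube algebra_simps c)
qed

section \<open>The embedded torus\<close>

lemma periodic_int_multiple:
  fixes h :: "real \<Rightarrow> 'a"
  assumes "\<And>s. h (s + 2*pi) = h s"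
  shows "h (s + 2*pi * of_int n) = h s"
proof -
  have nat: "h (s + 2*pi * real k) = h s" for s k
  proof (induction k)
    case (Suc k)
    have "s + 2*pi * real (Suc k) = (s + 2*pi * real k) + 2*pi" by (simp add: algebra_simps)
    then show ?case using Suc assms by metis
  qed simp
  show ?thesis
  proof (cases "0 \<le> n")
    case True
    then show ?thesis using nat[of s "nat n"] by simp
  next
    case False
    then show ?thesis using nat[of "s + 2*pi * of_int n" "nat (- n)"] by simp
  qed
qed

lemma periodic_eq_of_cis_eq:
  assumes "\<And>s. h (s + 2*pi) = h s" "cis x = cis y"
  shows "h x = h y"
proof -
  have "sin x = sin y \<and> cos x = cos y" using assms(2) by (simp add: complex_eq_iff)
  then obtain n :: int where "x = y + 2*pi * n" using sin_cos_eq_iff by blast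
  then show ?thesis using periodic_int_multiple[of h y n] assms(1) by metis
qed

lemma cis_Arg_circle: "z \<in> sphere 0 1 \<Longrightarrow> cis (Arg z) = z"
  by (subst cis_Arg) (auto simp: sgn_eq)

lemma periodic_Arg_cis:
  assumes "\<And>s. h (s + 2*pi) = h s"
  shows "h (Arg (cis x)) = h x"
  by (rule periodic_eq_of_cis_eq) (use assms in \<open>auto simp: cis_Arg_circle\<close>)

text \<open>\<open>Arg\<close> jumps on the negative axis. Near a given z0 it may be replaced by Arg
  (z / z0) + Arg z0, which has the same \<open>cis\<close> and is continuous at z0 because z / z0 is
  near 1; a periodic \<open>h\<close> does not notice the replacement.\<close>

lemma continuous_on_periodic_Arg:
  fixes h :: "real \<Rightarrow> 'a::topological_space"
  assumes h: "continuous_on UNIV h" and per: "\<And>s. h (s + 2*pi) = h s"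
  shows "continuous_on (sphere 0 1) (\<lambda>z. h (Arg z))"
  unfolding continuous_on_eq_continuous_within
proof
  fix z0 :: complex assume z0: "z0 \<in> sphere 0 1"
  then have nz: "z0 \<noteq> 0" by auto
  have "h (Arg (z / z0) + Arg z0) = h (Arg z)" if z: "z \<in> sphere 0 1" for z
  proof (rule periodic_eq_of_cis_eq[where h = h])
    show "h (s + 2*pi) = h s" for s by (rule per)
    have "z / z0 \<in> sphere 0 1" using z z0 by (simp add: norm_divide)
    then show "cis (Arg (z / z0) + Arg z0) = cis (Arg z)"
      using z z0 nz by (simp add: cis_mult[symmetric] cis_Arg_circle)
  qed
  moreover have "continuous (at z0 within sphere 0 1) (\<lambda>z. h (Arg (z / z0) + Arg z0))"
  proof (rule continuous_at_imp_continuous_within)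
    have "isCont (\<lambda>z. z / z0) z0" using nz by (intro continuous_intros)
    then have "isCont (\<lambda>z. Arg (z / z0)) z0"
      by (rule isCont_o2) (use nz in \<open>simp add: continuous_at_Arg\<close>)
    then have "isCont (\<lambda>z. Arg (z / z0) + Arg z0) z0" by (intro continuous_intros)
    then show "isCont (\<lambda>z. h (Arg (z / z0) + Arg z0)) z0"
      by (rule isCont_o2) (use h in \<open>simp add: continuous_on_eq_continuous_at\<close>)
  qed
  ultimately show "continuous (at z0 within sphere 0 1) (\<lambda>z. h (Arg z))"
    using z0 continuous_transform_within[of z0 "sphere 0 1" "\<lambda>z. h (Arg (z / z0) + Arg z0)" 1 "\<lambda>z. h (Arg z)"]
    by simp
qed

section \<open>Charts of the torus by boxes of angles\<close>

lemma Arg_cis_small: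
  assumes "\<bar>s\<bar> < pi"
  shows "Arg (cis s) = s"
  using assms by (intro Arg_cis) auto

lemma cis_in_nonpos_Reals_iff:
  assumes "\<bar>s\<bar> < pi"
  shows "cis s \<notin> \<real>\<^sub>\<le>\<^sub>0"
proof
  assume "cis s \<in> \<real>\<^sub>\<le>\<^sub>0"
  then have "Re (cis s) \<le> 0" "Im (cis s) = 0" by (simp_all add: complex_nonpos_Reals_iff)
  moreover have "cis s \<noteq> 0" by (rule cis_neq_zero)
  ultimately have "Re (cis s) < 0" "Im (cis s) = 0"
    by (simp_all add: complex_eq_iff less_le del: cis.sel)
  then have "Arg (cis s) = pi" by (simp add: Arg_eq_pi)
  then show False using Arg_cis_small[OF assms] assms by simp
qed

lemma Arg_abs_less:
  assumes "z \<notin> \<real>\<^sub>\<le>\<^sub>0"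
  shows "\<bar>Arg z\<bar> < pi"
proof -
  have "Arg z \<noteq> pi" using assms by (auto simp: Arg_eq_pi complex_nonpos_Reals_iff)
  then show ?thesis using mpi_less_Arg[of z] Arg_le_pi[of z] by simp
qed

definition angle_box :: "real^4 \<Rightarrow> (real^4) set" where
  "angle_box a = {t. \<forall>i. \<bar>t$i - a$i\<bar> < pi}"

lemma open_angle_box: "open (angle_box a)"
  unfolding angle_box_def forall_4 by (intro open_Collect_conj open_Collect_less continuous_intros)


lemma mem_angle_box: "a \<in> angle_box a"
  by (simp add: angle_box_def)

definition angles_inverse :: "real^4 \<Rightarrow> complex \<times> complex \<times> complex \<times> complex \<Rightarrow> real^4" where
  "angles_inverse a = (\<lambda>(z1, z2, z3, z4). \<chi> i. a$i + Arg ((if i = 1 then z1 else if i = 2 then z2 else if i = 3 then z3 else z4) / cis (a$i)))"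

lemma cis_diff_eq: "cis x / cis a = cis (x - a)"
  by (simp add: cis_divide)

text \<open>After rotation by the centre of the box, each coordinate ranges over the circle without
  -1. Writing this through the slit plane gives both openness of the image and continuity of
  \<open>Arg\<close> on it.\<close>

lemma angles_image_angle_box:
  "angles ` angle_box a = T4 \<inter> {(z1, z2, z3, z4). z1 / cis (a$1) \<in> - \<real>\<^sub>\<le>\<^sub>0 \<and> z2 / cis (a$2) \<in> - \<real>\<^sub>\<le>\<^sub>0
     \<and> z3 / cis (a$3) \<in> - \<real>\<^sub>\<le>\<^sub>0 \<and> z4 / cis (a$4) \<in> - \<real>\<^sub>\<le>\<^sub>0}" (is "_ = ?R")
proof
  show "angles ` angle_box a \<subseteq> ?R"
    by (auto simp: angles_def angle_box_def cis_diff_eq cis_in_nonpos_Reals_iff)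
  show "?R \<subseteq> angles ` angle_box a"
  proof
    fix z assume z: "z \<in> ?R"
    obtain z1 z2 z3 z4 where z_eq: "z = (z1, z2, z3, z4)" by (metis prod.exhaust)
    have S1: "z1 \<in> S1" "z2 \<in> S1" "z3 \<in> S1" "z4 \<in> S1"
      and "z1 / cis (a$1) \<in> - \<real>\<^sub>\<le>\<^sub>0" "z2 / cis (a$2) \<in> - \<real>\<^sub>\<le>\<^sub>0"
       "z3 / cis (a$3) \<in> - \<real>\<^sub>\<le>\<^sub>0" "z4 / cis (a$4) \<in> - \<real>\<^sub>\<le>\<^sub>0"
      using z by (auto simp: z_eq)
    then have "angles_inverse a (z1, z2, z3, z4) \<in> angle_box a"
      unfolding angle_box_def forall_4 by (simp add: angles_inverse_def Arg_abs_less)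
    moreover have "cis (x + Arg (z / cis x)) = z" if "z \<in> S1" for x z
      using that cis_Arg_circle[of "z / cis x"] by (simp add: cis_mult[symmetric] norm_divide)
    then have "angles (angles_inverse a (z1, z2, z3, z4)) = (z1, z2, z3, z4)"
      using S1 by (simp add: angles_def angles_inverse_def)
    ultimately show "z \<in> angles ` angle_box a" unfolding z_eq by (rule rev_image_eqI[OF _ sym])
  qed
qed

lemma openin_angles_image_angle_box: "openin (top_of_set T4) (angles ` angle_box a)"
proof -
  have "closed (\<real>\<^sub>\<le>\<^sub>0 :: complex set)" by simp
  then have "open {z::complex \<times> complex \<times> complex \<times> complex. f z / cis x \<in> - \<real>\<^sub>\<le>\<^sub>0}"
    if "continuous_on UNIV f" for f x
  proof -
    have "continuous_on UNIV (\<lambda>z. f z / cis x)" using that by (intro continuous_intros) auto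
    from open_vimage[OF open_Compl[OF \<open>closed \<real>\<^sub>\<le>\<^sub>0\<close>] this] show ?thesis by (simp add: vimage_def)
  qed
  from this[OF continuous_on_fst[OF continuous_on_id]]
    this[OF continuous_on_fst[OF continuous_on_snd[OF continuous_on_id]]]
    this[OF continuous_on_fst[OF continuous_on_snd[OF continuous_on_snd[OF continuous_on_id]]]]
    this[OF continuous_on_snd[OF continuous_on_snd[OF continuous_on_snd[OF continuous_on_id]]]]
  have "open {(z1, z2, z3, z4). z1 / cis (a$1) \<in> - \<real>\<^sub>\<le>\<^sub>0 \<and> z2 / cis (a$2) \<in> - \<real>\<^sub>\<le>\<^sub>0
     \<and> z3 / cis (a$3) \<in> - \<real>\<^sub>\<le>\<^sub>0 \<and> z4 / cis (a$4) \<in> - \<real>\<^sub>\<le>\<^sub>0}"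
    unfolding case_prod_unfold by (intro open_Collect_conj) auto
  then show ?thesis unfolding angles_image_angle_box by (rule openin_open_Int)
qed

lemma homeomorphism_angles:
  "homeomorphism (angle_box a) (angles ` angle_box a) angles (angles_inverse a)"
proof (rule homeomorphismI)
  show "continuous_on (angle_box a) angles"
    unfolding angles_def[abs_def] by (intro continuous_intros)
  have "continuous_on (angles ` angle_box a) (\<lambda>z. Arg ((if i = 1 then fst z else if i = 2 then fst (snd z)
      else if i = 3 then fst (snd (snd z)) else snd (snd (snd z))) / cis (a$i)))" for i
    unfolding angles_image_angle_box
    using exhaust_4[of i] by (auto intro!: continuous_intros)
  then show "continuous_on (angles ` angle_box a) (angles_inverse a)"
    unfolding angles_inverse_def case_prod_unfold
    by (intro continuous_on_vec_lambda continuous_on_add continuous_on_const)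
  have inv: "angles_inverse a (angles t) = t" if "t \<in> angle_box a" for t
    using that by (auto simp: angles_inverse_def angles_def vec_eq_iff forall_4 cis_diff_eq angle_box_def Arg_cis_small)
  then show "angles_inverse a ` angles ` angle_box a \<subseteq> angle_box a" by force
  show "angles_inverse a (angles t) = t" if "t \<in> angle_box a" for t using inv that .
  show "angles (angles_inverse a z) = z" if "z \<in> angles ` angle_box a" for z using inv that by force
qed simp

lemma angles_image: "angles ` UNIV = T4"
proof
  show "angles ` UNIV \<subseteq> T4" by (auto simp: angles_def)
  show "T4 \<subseteq> angles ` UNIV"
  proof
    fix z assume z: "z \<in> T4"
    obtain z1 z2 z3 z4 where z_eq: "z = (z1, z2, z3, z4)" by (metis prod.exhaust)
    have "z1 \<in> S1" "z2 \<in> S1" "z3 \<in> S1" "z4 \<in> S1" using z by (auto simp: z_eq)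
    then have "angles (\<chi> i. if i = 1 then Arg z1 else if i = 2 then Arg z2 else if i = 3 then Arg z3 else Arg z4) =
      (z1, z2, z3, z4)"
      by (simp add: angles_def cis_Arg_circle)
    then show "z \<in> range angles" unfolding z_eq by (rule range_eqI[OF sym])
  qed
qed

text \<open>Compactness turns continuity and injectivity into a homeomorphism onto the image.
  Composing it with the angle charts yields the local parametrizations, all restrictions of one map
  on the whole of angle space, so the curvature is checked once for that map.\<close>

lemma minimal_embedding_T4_S5_intro:
  assumes sphere: "F ` T4 \<subseteq> S5" and cont: "continuous_on T4 F" and inj: "inj_on F T4"
    and imm: "\<And>S. immersion_on (F \<circ> angles) S"
    and H: "\<And>t \<nu>. unit_normal (F \<circ> angles) t \<nu> \<Longrightarrow> mean_curvature (F \<circ> angles) t \<nu> = 0"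
  shows "minimal_embedding_T4_S5 F"
proof -
  have "compact T4" by (intro compact_Times compact_sphere)
  then obtain G where G: "homeomorphism T4 (F ` T4) F G"
    using homeomorphism_compact[OF _ cont refl inj] by blast
  have local: "local_parametrization (F ` T4) (angle_box a) (F \<circ> angles)" for a
    unfolding local_parametrization_def
  proof (intro conjI)
    have sub: "angles ` angle_box a \<subseteq> T4" using angles_image by blast
    have "openin (top_of_set (F ` T4)) (F ` angles ` angle_box a)"
      by (rule homeomorphism_imp_open_map[OF G openin_angles_image_angle_box])
    then show "openin (top_of_set (F ` T4)) ((F \<circ> angles) ` angle_box a)" by (simp add: image_comp)
    have "homeomorphism (angles ` angle_box a) (F ` angles ` angle_box a) F G"
      using homeomorphism_of_subsets[OF G sub] sub by blast
    from homeomorphism_compose[OF homeomorphism_angles this]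
    show "\<exists>Y. homeomorphism (angle_box a) ((F \<circ> angles) ` angle_box a) (F \<circ> angles) Y"
      by (auto simp: image_comp)
  qed (use imm open_angle_box in auto)
  have "\<exists>U X. local_parametrization (F ` T4) U X \<and> p \<in> X ` U \<and>
      (\<forall>t\<in>U. \<forall>\<nu>. unit_normal X t \<nu> \<longrightarrow> mean_curvature X t \<nu> = 0)" if p: "p \<in> F ` T4" for p
  proof -
    from p obtain a where "p = (F \<circ> angles) a" unfolding angles_image[symmetric] by auto
    then have "p \<in> (F \<circ> angles) ` angle_box a" using mem_angle_box by blast
    with local H show ?thesis by blast
  qed
  then have "minimal_hypersurface_S5 (F ` T4)"
    unfolding minimal_hypersurface_S5_def using sphere by blast
  then show ?thesis
    unfolding minimal_embedding_T4_S5_def smooth_embedding_T4_def using sphere imm G by blast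
qed

section \<open>The torus generated by a profile\<close>

locale profile =
  fixes g p :: "real \<Rightarrow> real"
  assumes g_deriv: "\<And>s. (g has_real_derivative p s) (at s)"
    and p_deriv: "\<And>s. (p has_real_derivative force (g s) (p s) (cos (3 * s)) (sin (3 * s)) - g s) (at s)"
    and g_periodic: "\<And>s. g (s + 2*pi/3) = g s"
    and tube: "\<And>s. tube (g s) (p s) (cos (3 * s)) (sin (3 * s))"
begin

text \<open>The radicand is the squared length of the ray with entries g + cos (s + 2 pi
  k/3).\<close>

definition scale :: "real \<Rightarrow> real" where "scale s = 1 / sqrt (3 * g s ^ 2 + 3/2)"
definition scale' :: "real \<Rightarrow> real" where "scale' s = - 3 * g s * p s * scale s ^ 3"
definition recip :: "real \<Rightarrow> real" where "recip s = 1 / denom (g s) (cos (3 * s))"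
definition p' :: "real \<Rightarrow> real" where "p' s = force (g s) (p s) (cos (3 * s)) (sin (3 * s)) - g s"

text \<open>The three coordinates of the curve are one function with phases 0, 2 pi/3 and 4
  pi/3.\<close>

definition \<gamma> :: "real \<Rightarrow> real \<Rightarrow> real" where
  "\<gamma> \<tau> s = scale s * (g s + cos (s + \<tau>))"
definition \<gamma>' :: "real \<Rightarrow> real \<Rightarrow> real" where
  "\<gamma>' \<tau> s = scale' s * (g s + cos (s + \<tau>)) + scale s * (p s - sin (s + \<tau>))"

lemma radicand_pos: "0 < 3 * g s ^ 2 + 3/2"
  by (rule add_nonneg_pos) auto

lemma scale_pos: "0 < scale s"
  using radicand_pos[of s] by (simp add: scale_def)

lemma scale_square: "scale s ^ 2 * (3 * g s ^ 2 + 3/2) = 1"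
  using radicand_pos[of s] by (simp add: scale_def power_divide)

lemma scale_deriv: "(scale has_real_derivative scale' s) (at s)"
proof -
  have "((\<lambda>s. sqrt (3 * g s ^ 2 + 3/2)) has_real_derivative (6 * g s * p s) * (inverse (sqrt (3 * g s ^ 2 + 3/2)) / 2)) (at s)"
    using radicand_pos[of s] g_deriv[of s]
    by (auto intro!: derivative_eq_intros simp: power2_eq_square)
  from DERIV_inverse'[OF this] show ?thesis
    unfolding scale_def[abs_def] scale'_def using radicand_pos[of s]
    by (simp add: inverse_eq_divide power3_eq_cube field_simps)
qed

lemma denom_pos: "0 < denom (g s) (cos (3 * s))"
  using tube_den_lower[OF tube[of s]] by linarith

lemma cos3_deriv: "((\<lambda>s. cos (3 * s)) has_real_derivative - 3 * sin (3 * s)) (at s)"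
  and sin3_deriv: "((\<lambda>s. sin (3 * s)) has_real_derivative 3 * cos (3 * s)) (at s)"
  for s :: real
  by (auto intro!: derivative_eq_intros)

lemma recip_deriv:
  "(recip has_real_derivative - (recip s ^ 2 * (12 * g s ^ 2 * p s - 3 * p s - 3 * sin (3 * s)))) (at s)"
proof -
  have "((\<lambda>s. denom (g s) (cos (3 * s))) has_real_derivative (12 * g s ^ 2 * p s - 3 * p s - 3 * sin (3 * s))) (at s)"
    unfolding denom_def using g_deriv[of s] cos3_deriv[of s]
    by (auto intro!: derivative_eq_intros simp: power2_eq_square)
  from DERIV_inverse'[OF this] show ?thesis
    using denom_pos[of s] by (simp add: recip_def[abs_def] inverse_eq_divide power2_eq_square)
qed

text \<open>The quotient 1 / (1 + 2 g^2) equals 3/2 \<open>scale\<close>^2, so no further generator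
  is needed to make this derivative polynomial.\<close>

lemma p'_eq: "p' s = (1 + 2 * g s ^ 2 + 2 * p s ^ 2) * (3/2 * scale s ^ 2) *
   ((12 * g s ^ 2 - 3/2 - 3 * g s * cos (3 * s) + 3 * p s * sin (3 * s)) * recip s) - g s"
proof -
  have *: "3/2 * scale s ^ 2 = 1 / (1 + 2 * g s ^ 2)"
    using scale_square[of s] radicand_pos[of s] by (simp add: field_simps)
  show ?thesis unfolding * p'_def force_def numer_def recip_def by simp
qed

lemma p_deriv': "(p has_real_derivative p' s) (at s)"
  using p_deriv by (simp add: p'_def)

text \<open>The irrational factor \<open>scale\<close> and the quotient \<open>recip\<close> are generators of their own, so that all derivatives of
  generators are polynomials in the generators.\<close>

definition generators :: "(real \<Rightarrow> real) set" where
  "generators = {cos, sin, \<lambda>s. cos (3 * s), \<lambda>s. sin (3 * s), g, p, scale, recip}"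

lemma generators_mem:
  "(\<lambda>t. cos (t $ j)) \<in> coordinate_algebra generators" "(\<lambda>t. sin (t $ j)) \<in> coordinate_algebra generators"
  "(\<lambda>t. cos (3 * t $ j)) \<in> coordinate_algebra generators" "(\<lambda>t. sin (3 * t $ j)) \<in> coordinate_algebra generators"
  "(\<lambda>t. g (t $ j)) \<in> coordinate_algebra generators" "(\<lambda>t. p (t $ j)) \<in> coordinate_algebra generators"
  "(\<lambda>t. scale (t $ j)) \<in> coordinate_algebra generators" "(\<lambda>t. recip (t $ j)) \<in> coordinate_algebra generators"
  by (rule coordinate_algebra.gen coordinate_algebra.gen[of "\<lambda>s. cos (3 * s)"] coordinate_algebra.gen[of "\<lambda>s. sin (3 * s)"],
      simp add: generators_def)+

lemma generators_closed: "closed_under_derivative generators TYPE('n::finite)"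
proof -
  define P where "P h \<longleftrightarrow> (\<exists>h'. (\<forall>x. (h has_real_derivative h' x) (at x)) \<and>
     (\<forall>j::'n. (\<lambda>t::real^'n. h' (t $ j)) \<in> coordinate_algebra generators))" for h
  have P: "P h" if "\<And>x. (h has_real_derivative h' x) (at x)"
      "\<And>j::'n. (\<lambda>t::real^'n. h' (t $ j)) \<in> coordinate_algebra generators" for h h'
    using that unfolding P_def by blast
  note intros = generators_mem coordinate_algebra_intros
  have "P cos" by (rule P[OF DERIV_cos]) (intro intros)
  moreover have "P sin" by (rule P[OF DERIV_sin]) (intro intros)
  moreover have "P (\<lambda>s. cos (3 * s))" by (rule P[OF cos3_deriv]) (intro intros)
  moreover have "P (\<lambda>s. sin (3 * s))" by (rule P[OF sin3_deriv]) (intro intros)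
  moreover have "P g" by (rule P[OF g_deriv]) (intro intros)
  moreover have "P p" by (rule P[OF p_deriv'], unfold p'_eq) (intro intros)
  moreover have "P scale" by (rule P[OF scale_deriv], unfold scale'_def) (intro intros)
  moreover have "P recip" by (rule P[OF recip_deriv]) (intro intros)
  ultimately have "P h" if "h \<in> generators" for h
    using that unfolding generators_def by blast
  then show ?thesis unfolding closed_under_derivative_def P_def by blast
qed

lemma ray_pos: "0 < g s + cos (s + \<tau>)"
proof -
  have "18415/10000 \<le> g s" by (rule tube_g_bounds(1)[OF tube])
  then show ?thesis using cos_ge_minus_one[of "s + \<tau>"] by linarith
qed

lemma \<gamma>_pos: "0 < \<gamma> \<tau> s"
  unfolding \<gamma>_def by (intro mult_pos_pos scale_pos ray_pos)

lemma \<gamma>_deriv: "(\<gamma> \<tau> has_real_derivative \<gamma>' \<tau> s) (at s)"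
  unfolding \<gamma>_def[abs_def] \<gamma>'_def
  by (auto intro!: derivative_eq_intros scale_deriv g_deriv)

text \<open>The second derivative of the scale is left unnamed, but common to all phases: in the
  curvature it multiplies the pairing of the ray with the normal, which is zero.\<close>

lemma \<gamma>'_deriv:
  "\<exists>m''. \<forall>\<tau>. (\<gamma>' \<tau> has_real_derivative
    m'' * (g s + cos (s + \<tau>)) + 2 * scale' s * (p s - sin (s + \<tau>)) + scale s * (p' s - cos (s + \<tau>))) (at s)"
proof -
  have "\<exists>m''. (scale' has_real_derivative m'') (at s)"
    unfolding scale'_def[abs_def]
    by (rule exI, rule DERIV_mult[OF DERIV_mult[OF DERIV_cmult[OF g_deriv] p_deriv'] DERIV_power[OF scale_deriv]])
  then obtain m'' where m'': "(scale' has_real_derivative m'') (at s)" ..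
  show ?thesis
  proof (intro exI allI)
    show "(\<gamma>' \<tau> has_real_derivative
      m'' * (g s + cos (s + \<tau>)) + 2 * scale' s * (p s - sin (s + \<tau>)) + scale s * (p' s - cos (s + \<tau>))) (at s)" for \<tau>
      unfolding \<gamma>'_def[abs_def]
      by (auto intro!: derivative_eq_intros m'' scale_deriv g_deriv p_deriv' simp: algebra_simps)
  qed
qed

lemma g_periodic': "g (s + 2*pi) = g s"
  using g_periodic[of s] g_periodic[of "s + 2*pi/3"] g_periodic[of "s + 2*pi/3 + 2*pi/3"]
  by (simp add: add.assoc)

lemma \<gamma>_periodic: "\<gamma> \<tau> (s + 2*pi) = \<gamma> \<tau> s"
proof -
  have "cos (s + 2*pi + \<tau>) = cos (s + \<tau>)" using cos_periodic[of "s + \<tau>"] by (simp add: add_ac)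
  then show ?thesis by (simp add: \<gamma>_def scale_def g_periodic')
qed

definition torus_map :: "complex \<times> complex \<times> complex \<times> complex \<Rightarrow> real^6" where
  "torus_map = (\<lambda>(z1, z2, z3, z4). vec6 (of_real (\<gamma> 0 (Arg z4)) * z1) (of_real (\<gamma> (2*pi/3) (Arg z4)) * z2)
     (of_real (\<gamma> (4*pi/3) (Arg z4)) * z3))"

lemma torus_map_angles:
  "torus_map \<circ> angles = wave (\<lambda>s. of_real (\<gamma> 0 s)) (\<lambda>s. of_real (\<gamma> (2*pi/3) s)) (\<lambda>s. of_real (\<gamma> (4*pi/3) s))"
  by (simp add: fun_eq_iff torus_map_def angles_def wave_def periodic_Arg_cis[of "\<gamma> _", OF \<gamma>_periodic])

lemma torus_map_smooth: "smooth_on (torus_map \<circ> angles) S"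
proof (rule coordinate_algebra_smooth_on[OF generators_closed])
  have "(\<lambda>t. \<gamma> \<tau> (t $ j)) \<in> coordinate_algebra generators" for \<tau> and j :: 4
    unfolding \<gamma>_def cos_add by (intro generators_mem coordinate_algebra_intros)
  then have "\<forall>i. (\<lambda>t. (torus_map \<circ> angles) t $ i) \<in> coordinate_algebra generators"
    unfolding torus_map_angles forall_6 wave_def
    by (simp add: generators_mem coordinate_algebra.mult)
  then show "(\<lambda>t. (torus_map \<circ> angles) t $ i) \<in> coordinate_algebra generators" for i by blast
qed

lemma sphere_equation: "\<gamma> 0 s ^ 2 + \<gamma> (2*pi/3) s ^ 2 + \<gamma> (4*pi/3) s ^ 2 = 1"
proof -
  have "\<gamma> 0 s ^ 2 + \<gamma> (2*pi/3) s ^ 2 + \<gamma> (4*pi/3) s ^ 2 =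
    scale s ^ 2 * ((g s + cos s)^2 + (g s + cos (s + 2*pi/3))^2 + (g s + cos (s + 4*pi/3))^2)"
    by (simp only: \<gamma>_def power_mult_distrib add_0_right) (simp only: distrib_left)
  then show ?thesis
    using third_turn_norms(1)[OF _ trig_third_turn, of s "g s"] scale_square[of s] by simp
qed

lemma speed_pos: "0 < \<gamma>' 0 s ^ 2 + \<gamma>' (2*pi/3) s ^ 2 + \<gamma>' (4*pi/3) s ^ 2"
proof -
  have "\<gamma>' 0 s ^ 2 + \<gamma>' (2*pi/3) s ^ 2 + \<gamma>' (4*pi/3) s ^ 2 = 9/4 * (1 + 2 * g s ^ 2 + 2 * p s ^ 2) * scale s ^ 4"
    unfolding \<gamma>'_def add_0_right
    by (rule speed_formula[OF _ trig_third_turn])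
      (use scale_pos[of s] scale_square[of s] in \<open>auto simp: scale'_def\<close>)
  also have "\<dots> > 0"
    using scale_pos[of s] by (intro mult_pos_pos zero_less_power add_pos_nonneg) auto
  finally show ?thesis .
qed

lemma torus_map_immersion: "immersion_on (torus_map \<circ> angles) S"
  unfolding immersion_on_def
proof (intro conjI ballI torus_map_smooth)
  show "inj (frechet_derivative (torus_map \<circ> angles) (at t))" for t
    by (rule wave_immersive[OF \<gamma>_deriv \<gamma>_deriv \<gamma>_deriv _ _ _ _ torus_map_angles])
      (use \<gamma>_pos speed_pos[of "t$4"] in \<open>simp_all add: less_imp_neq[THEN not_sym]\<close>)
qed

lemma torus_map_minimal:
  assumes "unit_normal (torus_map \<circ> angles) t \<nu>"
  shows "mean_curvature (torus_map \<circ> angles) t \<nu> = 0"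
proof -
  obtain m'' where m'': "\<And>s \<tau>. (\<gamma>' \<tau> has_real_derivative
    m'' s * (g s + cos (s + \<tau>)) + 2 * scale' s * (p s - sin (s + \<tau>)) + scale s * (p' s - cos (s + \<tau>))) (at s)"
    using \<gamma>'_deriv by metis
  define s where "s = t $ 4"
  have nz: "\<gamma> \<tau> s \<noteq> 0" for \<tau> using \<gamma>_pos[of \<tau> s] by simp
  have speed: "\<gamma>' 0 s ^ 2 + \<gamma>' (2*pi/3) s ^ 2 + \<gamma>' (4*pi/3) s ^ 2 \<noteq> 0" using speed_pos[of s] by simp
  obtain n1 n2 n3 where n: "\<gamma> 0 s * n1 + \<gamma> (2*pi/3) s * n2 + \<gamma> (4*pi/3) s * n3 = 0"
    "\<gamma>' 0 s * n1 + \<gamma>' (2*pi/3) s * n2 + \<gamma>' (4*pi/3) s * n3 = 0"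
    and H: "mean_curvature (torus_map \<circ> angles) t \<nu> = - (n1 / \<gamma> 0 s + n2 / \<gamma> (2*pi/3) s + n3 / \<gamma> (4*pi/3) s) +
      ((m'' s * (g s + cos (s + 0)) + 2 * scale' s * (p s - sin (s + 0)) + scale s * (p' s - cos (s + 0))) * n1
       + (m'' s * (g s + cos (s + 2*pi/3)) + 2 * scale' s * (p s - sin (s + 2*pi/3)) + scale s * (p' s - cos (s + 2*pi/3))) * n2
       + (m'' s * (g s + cos (s + 4*pi/3)) + 2 * scale' s * (p s - sin (s + 4*pi/3)) + scale s * (p' s - cos (s + 4*pi/3))) * n3)
      / (\<gamma>' 0 s ^ 2 + \<gamma>' (2*pi/3) s ^ 2 + \<gamma>' (4*pi/3) s ^ 2)"
    using mean_curvature_wave[OF \<gamma>_deriv \<gamma>_deriv \<gamma>_deriv m'' m'' m'' nz[unfolded s_def] nz[unfolded s_def] nz[unfolded s_def]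
        speed[unfolded s_def] torus_map_angles assms]
    unfolding s_def by blast
  have ray: "g s + cos s \<noteq> 0" "g s + cos (s + 2*pi/3) \<noteq> 0" "g s + cos (s + 4*pi/3) \<noteq> 0"
    using ray_pos[of s 0] ray_pos[of s "2*pi/3"] ray_pos[of s "4*pi/3"] by simp_all
  have p': "p' s = force (g s) (p s) (4 * cos s ^ 3 - 3 * cos s) (3 * sin s - 4 * sin s ^ 3) - g s"
    by (simp add: p'_def triple_angle)
  have m: "scale s \<noteq> 0" using scale_pos[of s] by simp
  show ?thesis
    unfolding H using n unfolding \<gamma>_def \<gamma>'_def add_0_right
    by (rule minimality_equation[OF _ trig_third_turn m scale_square scale'_def ray p', rotated])
      (simp_all add: mult.assoc)
qed

lemma torus_map_continuous: "continuous_on T4 torus_map"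
proof -
  have "continuous_on UNIV (\<gamma> \<tau>)" for \<tau>
    using DERIV_isCont[OF \<gamma>_deriv] by (simp add: continuous_on_eq_continuous_at)
  then have \<gamma>: "continuous_on S1 (\<lambda>z. \<gamma> \<tau> (Arg z))" for \<tau>
    by (rule continuous_on_periodic_Arg) (rule \<gamma>_periodic)
  have "continuous_on T4 (\<lambda>z. \<gamma> \<tau> (Arg (snd (snd (snd z)))))" for \<tau>
    by (rule continuous_on_compose2[OF \<gamma>]) (auto intro!: continuous_intros)
  then show ?thesis
    unfolding torus_map_def case_prod_unfold by (intro continuous_intros)
qed

lemma torus_map_sphere: "torus_map ` T4 \<subseteq> S5"
proof
  fix v assume "v \<in> torus_map ` T4"
  then obtain z1 z2 z3 z4 where z: "cmod z1 = 1" "cmod z2 = 1" "cmod z3 = 1"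
    and v: "v = torus_map (z1, z2, z3, z4)"
    by auto
  have "norm v ^ 2 = 1"
    unfolding v torus_map_def using sphere_equation[of "Arg z4"] z
    by (simp add: norm_vec6 norm_mult)
  then have "norm v = 1" using norm_ge_zero[of v] by (simp add: power2_eq_1_iff del: norm_ge_zero)
  then show "v \<in> S5" by simp
qed

text \<open>A three-point discrete Fourier transform: the mean of the coordinates gives
  \<open>scale * g\<close>, the remainder gives \<open>scale * cos\<close> and
  \<open>scale * sin\<close>. Their squares add up to \<open>scale\<close>^2, so positivity recovers
  the scale and then the point of the circle.\<close>

lemma \<gamma>_injective:
  assumes eq: "\<gamma> 0 x = \<gamma> 0 y" "\<gamma> (2*pi/3) x = \<gamma> (2*pi/3) y" "\<gamma> (4*pi/3) x = \<gamma> (4*pi/3) y"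
  shows "cis x = cis y"
proof -
  have sum: "scale s * g s = (\<gamma> 0 s + \<gamma> (2*pi/3) s + \<gamma> (4*pi/3) s) / 3" for s
    unfolding \<gamma>_def trig_third_turn add_0_right by (simp add: field_simps)
  have cos: "scale s * cos s = \<gamma> 0 s - scale s * g s" for s
    unfolding \<gamma>_def by (simp add: algebra_simps)
  have sin: "scale s * sin s = (\<gamma> (4*pi/3) s - \<gamma> (2*pi/3) s) / sqrt 3" for s
    unfolding \<gamma>_def trig_third_turn by (simp add: field_simps)
  have c: "scale x * cos x = scale y * cos y" unfolding cos sum eq ..
  have s: "scale x * sin x = scale y * sin y" unfolding sin eq ..
  have sq: "scale s ^ 2 = (scale s * cos s)^2 + (scale s * sin s)^2" for s
    by (simp add: power_mult_distrib distrib_left[symmetric])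
  have "scale x ^ 2 = scale y ^ 2" unfolding sq[of x] sq[of y] c s ..
  then have "scale x = scale y"
    using scale_pos[of x] scale_pos[of y] by (simp add: power2_eq_iff_nonneg)
  then show ?thesis
    using c s scale_pos[of y] by (simp add: complex_eq_iff)
qed

lemma torus_map_inj: "inj_on torus_map T4"
proof (rule inj_onI)
  fix z w assume z: "z \<in> T4" and w: "w \<in> T4" and eq: "torus_map z = torus_map w"
  obtain z1 z2 z3 z4 where z_eq: "z = (z1, z2, z3, z4)" by (metis prod.exhaust)
  obtain w1 w2 w3 w4 where w_eq: "w = (w1, w2, w3, w4)" by (metis prod.exhaust)
  \<comment> \<open>Each complex component is in polar form, so its modulus and phase can be read
    off separately.\<close>
  have comp: "a = b \<and> u = v"
    if "of_real a * u = of_real b * v" "norm u = 1" "norm v = 1" "0 < a" "0 < b" for a b :: real and u v :: complex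
  proof -
    have "norm (of_real a * u) = norm (of_real b * v)" using that(1) by (rule arg_cong)
    then have "a = b" using that(2-5) by (simp add: norm_mult)
    then show ?thesis using that by simp
  qed
  have e: "of_real (\<gamma> 0 (Arg z4)) * z1 = of_real (\<gamma> 0 (Arg w4)) * w1"
    "of_real (\<gamma> (2*pi/3) (Arg z4)) * z2 = of_real (\<gamma> (2*pi/3) (Arg w4)) * w2"
    "of_real (\<gamma> (4*pi/3) (Arg z4)) * z3 = of_real (\<gamma> (4*pi/3) (Arg w4)) * w3"
    using eq by (simp_all add: torus_map_def z_eq w_eq vec6_eq_iff)
  have n: "norm z1 = 1" "norm z2 = 1" "norm z3 = 1" "norm w1 = 1" "norm w2 = 1" "norm w3 = 1"
    and S: "z4 \<in> S1" "w4 \<in> S1"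
    using z w by (auto simp: z_eq w_eq)
  note c = comp[OF e(1) n(1,4) \<gamma>_pos \<gamma>_pos] comp[OF e(2) n(2,5) \<gamma>_pos \<gamma>_pos] comp[OF e(3) n(3,6) \<gamma>_pos \<gamma>_pos]
  have "cis (Arg z4) = cis (Arg w4)" using c by (intro \<gamma>_injective) simp_all
  then show "z = w" using c S by (simp add: z_eq w_eq cis_Arg_circle)
qed

lemma torus_map_minimal_embedding: "minimal_embedding_T4_S5 torus_map"
  by (intro minimal_embedding_T4_S5_intro torus_map_sphere torus_map_continuous torus_map_inj
      torus_map_immersion torus_map_minimal)

end

theorem theoremA1:
  "\<exists>F :: complex \<times> complex \<times> complex \<times> complex \<Rightarrow> real^6. minimal_embedding_T4_S5 F"
proof -
  obtain g p where "profile g p"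
    by (rule profile_exists) (auto simp: profile_def)
  then show ?thesis by (blast intro: profile.torus_map_minimal_embedding)
qed

end
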